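(* Let $(T,X,\mu)$ be an ergodic measure-preserving dynamical system ($\mu$ a probability measure) with transfer operator $P$, and assume that $P$, restricted to the space $BV(X)$ of functions of bounded variation, contracts exponentially: there are $C>0$ and $\theta\in(0,1)$ such that $$\|P^n\phi\|_{BV}\le C\theta^n\|\phi\|_{BV}$$ for all $n$ and all $\phi\in BV(X)$ with $\int\phi\,d\mu=0$. Let $B_i:=B(p,r_i)$ be nested balls of radius $r_i$ about a point $p$ such that $\mu(B_i)=\frac1i$, and let $$a_n^2=E\Big[\Big(\sum_{i=1}^n\big(1_{B_i}\circ T^i-\tfrac1i\big)\Big)^2\Big].$$ Then: (I) $\displaystyle\limsup_{n\to\infty}\frac{a_n}{\sqrt{\log n}}\ge1$ and $$\frac1{a_n}\sum_{i=1}^n\Big(1_{B_i}\circ T^i-\frac1i\Big)\to N(0,1)$$ in distribution. (II) If the nested sequence of balls $(B_i(p))$ about $p$ satisfies Assumption (C), then $$a_n^2=\log n+\mathcal{O}(1)$$ and $$\frac1{\sqrt{\log n}}\sum_{i=1}^n\Big(1_{B_i}\circ T^i-\frac1i\Big)\to N(0,1)$$ in distribution.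
   Context: The transfer operator $P$ is the adjoint of the Koopman operator $\phi\mapsto\phi\circ T$ with respect to $\mu$: $\int\phi\,(\psi\circ T)\,d\mu=\int (P\phi)\,\psi\,d\mu$ for all $\phi,\psi\in L^2(\mu)$. $E[\cdot]$ is the integral with respect to $\mu$. $X$ is a space on which functions of bounded variation are defined (in the paper's examples of this setting a compact interval), and $BV(X)$ is the Banach space of functions of bounded variation with norm $\|\cdot\|_{BV}$. It satisfies $\|\phi\|_{L^1(\mu)}\le C\|\phi\|_{BV}$ and $\|\phi\|_\infty\le C\|\phi\|_{BV}$, and the indicator functions $1_{B_i}$ lie in $BV(X)$ with uniformly bounded norm. Nested means $B_{i+1}\subset B_i$. Assumption (C): there exist $\eta(p)\in(0,1)$ and $\kappa(p)>1$ such that for all $i$ sufficiently large, $\mu(B_i(p)\cap T^{-r}B_i(p))\le\mu(B_i(p))^{1+\eta}$ for all integers $r=1,\ldots,\log^\kappa i$. *)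

theory Defs
  imports "HOL-Probability.Probability" "HOL-Library.Landau_Symbols"
begin

definition ergodic_system :: "'a measure \<Rightarrow> ('a \<Rightarrow> 'a) \<Rightarrow> bool" where
  "ergodic_system M T \<longleftrightarrow>
     prob_space M \<and> T \<in> measurable M M \<and> distr M M T = M \<and>
     (\<forall>A\<in>sets M. T -` A \<inter> space M = A \<longrightarrow> measure M A = 0 \<or> measure M A = 1)"

definition L2 :: "'a measure \<Rightarrow> ('a \<Rightarrow> real) set" where
  "L2 M = {\<phi> \<in> borel_measurable M. integrable M (\<lambda>x. (\<phi> x)\<^sup>2)}"

text \<open>
  Functions are not identified when they agree almost everywhere, so the defining duality determines
  \<open>P \<phi>\<close> only up to a null set and \<open>P\<close> ranges over all choices of representatives. Everything below
  depends on \<open>P \<phi>\<close> only through its class.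
\<close>

definition transfer_operator ::
  "'a measure \<Rightarrow> ('a \<Rightarrow> 'a) \<Rightarrow> (('a \<Rightarrow> real) \<Rightarrow> ('a \<Rightarrow> real)) \<Rightarrow> bool" where
  "transfer_operator M T P \<longleftrightarrow>
     (\<forall>\<phi>\<in>L2 M. P \<phi> \<in> L2 M \<and>
        (\<forall>\<psi>\<in>L2 M. (\<integral>x. \<phi> x * \<psi> (T x) \<partial>M) = (\<integral>x. P \<phi> x * \<psi> x \<partial>M)))"

text \<open>
  Variation is measured along a family \<open>K\<close> of finite chains of points of \<open>X\<close>. For a compact interval,
  or any other \<open>X \<subseteq> \<real>\<close>, the classical notion is \<open>K = increasing_chains X\<close>; leaving \<open>K\<close> open allows
  spaces without a linear order (the circle, trees, \dots).
\<close>

definition increasing_chains :: "'a::linorder set \<Rightarrow> 'a list set" where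
  "increasing_chains X = {xs \<in> lists X. sorted xs}"

definition variation :: "'a list set \<Rightarrow> ('a \<Rightarrow> real) \<Rightarrow> ennreal" where
  "variation K g = (SUP xs\<in>K. \<Sum>i<length xs - 1. ennreal \<bar>g (xs ! Suc i) - g (xs ! i)\<bar>)"

text \<open>
  As elements of \<open>BV(X)\<close> are acted on by the transfer operator, they are taken modulo null sets: the
  variation of a class is the infimum of the variations of its representatives.
\<close>

definition ess_variation :: "'a measure \<Rightarrow> 'a list set \<Rightarrow> ('a \<Rightarrow> real) \<Rightarrow> ennreal" where
  "ess_variation M K \<phi> =
     (INF g\<in>{g \<in> borel_measurable M. AE x in M. g x = \<phi> x}. variation K g)"

definition BV :: "'a measure \<Rightarrow> 'a list set \<Rightarrow> ('a \<Rightarrow> real) set" where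
  "BV M K = {\<phi>. integrable M \<phi> \<and> ess_variation M K \<phi> < \<infinity>}"

definition bv_norm :: "'a measure \<Rightarrow> 'a list set \<Rightarrow> ('a \<Rightarrow> real) \<Rightarrow> real" where
  "bv_norm M K \<phi> = (\<integral>x. \<bar>\<phi> x\<bar> \<partial>M) + enn2real (ess_variation M K \<phi>)"

lemma L1_le_bv_norm: "(\<integral>x. \<bar>\<phi> x\<bar> \<partial>M) \<le> bv_norm M K \<phi>"
  by (simp add: bv_norm_def)

text \<open>
  For the classical variation on a subset of the line, the two remaining standing properties of
  \<open>BV(X)\<close> -- the bound on the supremum norm and the uniform bound for indicators of balls -- hold
  automatically.
\<close>

lemma sup_le_bv_norm_increasing:
  fixes M :: "'a::linorder measure"
  assumes "prob_space M" and \<phi>: "\<phi> \<in> BV M (increasing_chains (space M))"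
  shows "AE x in M. \<bar>\<phi> x\<bar> \<le> bv_norm M (increasing_chains (space M)) \<phi>"
proof -
  interpret prob_space M by fact
  let ?K = "increasing_chains (space M)"
  define v where "v = enn2real (ess_variation M ?K \<phi>)"
  have fin: "ess_variation M ?K \<phi> < \<infinity>" and int: "integrable M \<phi>"
    using \<phi> by (auto simp: BV_def)
  have v: "ess_variation M ?K \<phi> = ennreal v" "0 \<le> v"
    using fin by (auto simp: v_def less_top)
  have "AE x in M. \<bar>\<phi> x\<bar> \<le> (\<integral>x. \<bar>\<phi> x\<bar> \<partial>M) + v + 1 / real (Suc n)" for n
  proof -
    have "ess_variation M ?K \<phi> < ennreal (v + 1 / real (Suc n))"
      using v by (simp add: ennreal_lessI)
    then obtain g where g: "g \<in> borel_measurable M" "AE x in M. g x = \<phi> x"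
      "variation ?K g < ennreal (v + 1 / real (Suc n))"
      unfolding ess_variation_def by (auto simp: INF_less_iff)
    have osc: "\<bar>g x - g y\<bar> \<le> v + 1 / real (Suc n)"
      if "x \<in> space M" "y \<in> space M" "x \<le> y" for x y
    proof -
      have "[x, y] \<in> ?K" using that by (auto simp: increasing_chains_def)
      then have "ennreal \<bar>g y - g x\<bar> \<le> variation ?K g"
        unfolding variation_def by (rule SUP_upper2) simp
      then have "ennreal \<bar>g y - g x\<bar> < ennreal (v + 1 / real (Suc n))"
        using g(3) by (rule le_less_trans)
      then show ?thesis by (simp add: ennreal_less_iff)
    qed
    have "AE x in M. \<phi> x = g x"
      using g(2) by eventually_elim simp
    then have intg: "integrable M (\<lambda>y. \<bar>g y\<bar>)"
      using integrable_cong_AE_imp[OF int g(1)] by (intro integrable_abs) blast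
    have eq: "(\<integral>y. \<bar>g y\<bar> \<partial>M) = (\<integral>y. \<bar>\<phi> y\<bar> \<partial>M)"
      using g(1,2) int by (intro integral_cong_AE) auto
    have "\<bar>g x\<bar> \<le> (\<integral>y. \<bar>\<phi> y\<bar> \<partial>M) + v + 1 / real (Suc n)" if x: "x \<in> space M" for x
    proof -
      have "\<bar>g x\<bar> - (v + 1 / real (Suc n)) \<le> \<bar>g y\<bar>" if y: "y \<in> space M" for y
        using osc[OF x y] osc[OF y x] linear[of x y] by linarith
      then have "(\<integral>y. \<bar>g x\<bar> - (v + 1 / real (Suc n)) \<partial>M) \<le> (\<integral>y. \<bar>g y\<bar> \<partial>M)"
        using intg by (intro integral_mono) auto
      then show ?thesis by (simp add: eq prob_space)
    qed
    then have "AE x in M. \<bar>g x\<bar> \<le> (\<integral>y. \<bar>\<phi> y\<bar> \<partial>M) + v + 1 / real (Suc n)"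
      by (rule AE_I2)
    with g(2) show ?thesis by eventually_elim simp
  qed
  then have "AE x in M. \<forall>n. \<bar>\<phi> x\<bar> \<le> (\<integral>x. \<bar>\<phi> x\<bar> \<partial>M) + v + 1 / real (Suc n)"
    by (simp add: AE_all_countable)
  then show ?thesis
  proof eventually_elim
    case (elim x)
    have "(\<lambda>n. (\<integral>x. \<bar>\<phi> x\<bar> \<partial>M) + v + 1 / real (Suc n)) \<longlonglongrightarrow> (\<integral>x. \<bar>\<phi> x\<bar> \<partial>M) + v + 0"
      by (intro tendsto_intros LIMSEQ_Suc lim_1_over_n)
    from LIMSEQ_le_const[OF this] elim show ?case by (auto simp: bv_norm_def v_def)
  qed
qed

lemma variation_indicator_ball_le:
  fixes p :: real
  shows "variation (increasing_chains X) (indicator (ball p r \<inter> X)) \<le> 2"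
  unfolding variation_def
proof (rule SUP_least)
  fix xs assume xs: "xs \<in> increasing_chains X"
  define a b :: "nat \<Rightarrow> real"
    where "a i = (if p - r < xs ! i then 1 else 0)"
      and "b i = (if p + r \<le> xs ! i \<and> p - r < xs ! i then 1 else 0)" for i
  let ?f = "indicator (ball p r \<inter> X) :: real \<Rightarrow> real"
  have f: "?f (xs ! i) = a i - b i" if "i < length xs" for i
    using xs that nth_mem[OF that]
    by (auto simp: a_def b_def increasing_chains_def dist_real_def indicator_def)
  have le: "xs ! i \<le> xs ! Suc i" if "Suc i < length xs" for i
    using xs that by (auto simp: increasing_chains_def intro: sorted_nth_mono)
  have "(\<Sum>i<length xs - 1. \<bar>?f (xs ! Suc i) - ?f (xs ! i)\<bar>)
      \<le> (\<Sum>i<length xs - 1. (a (Suc i) - a i) + (b (Suc i) - b i))"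
  proof (rule sum_mono)
    fix i assume "i \<in> {..<length xs - 1}"
    then have i: "Suc i < length xs" by auto
    then have i': "i < length xs" by auto
    have "a i \<le> a (Suc i)" "b i \<le> b (Suc i)" using le[OF i] by (auto simp: a_def b_def)
    then show "\<bar>?f (xs ! Suc i) - ?f (xs ! i)\<bar> \<le> (a (Suc i) - a i) + (b (Suc i) - b i)"
      unfolding f[OF i] f[OF i'] by linarith
  qed
  also have "\<dots> = (a (length xs - 1) - a 0) + (b (length xs - 1) - b 0)"
    by (simp add: sum.distrib sum_lessThan_telescope)
  also have "\<dots> \<le> 2" by (auto simp: a_def b_def)
  finally show "(\<Sum>i<length xs - 1. ennreal \<bar>?f (xs ! Suc i) - ?f (xs ! i)\<bar>) \<le> 2"
    by (subst sum_ennreal) (auto simp flip: ennreal_numeral intro!: ennreal_leI)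
qed

definition centred_hits :: "('a \<Rightarrow> 'a) \<Rightarrow> (nat \<Rightarrow> 'a set) \<Rightarrow> nat \<Rightarrow> 'a \<Rightarrow> real" where
  "centred_hits T B n x = (\<Sum>i=1..n. indicator (B i) ((T ^^ i) x) - 1 / real i)"

definition hits_sd :: "'a measure \<Rightarrow> ('a \<Rightarrow> 'a) \<Rightarrow> (nat \<Rightarrow> 'a set) \<Rightarrow> nat \<Rightarrow> real" where
  "hits_sd M T B n = sqrt (\<integral>x. (centred_hits T B n x)\<^sup>2 \<partial>M)"

definition assumption_C :: "'a measure \<Rightarrow> ('a \<Rightarrow> 'a) \<Rightarrow> (nat \<Rightarrow> 'a set) \<Rightarrow> bool" where
  "assumption_C M T B \<longleftrightarrow>
     (\<exists>\<eta> \<kappa> :: real. 0 < \<eta> \<and> \<eta> < 1 \<and> 1 < \<kappa> \<and>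
        (\<forall>\<^sub>F i in sequentially. \<forall>r::nat. 1 \<le> r \<and> real r \<le> ln (real i) powr \<kappa> \<longrightarrow>
           measure M (B i \<inter> (T ^^ r) -` B i) \<le> measure M (B i) powr (1 + \<eta>)))"

end

theory Submission
  imports Defs "HOL-Real_Asymp.Real_Asymp"
begin

text \<open>
  Write \<open>\<phi>\<^sub>i\<close> for the centred indicator of \<open>B\<^sub>i\<close> and \<open>h\<^sub>k\<close> for the sum of the
  \<open>P\<^sup>k\<^sup>-\<^sup>j \<phi>\<^sub>j\<close> with \<open>j < k\<close>, which is bounded in \<open>BV\<close> and satisfies \<open>E[h\<^sub>k\<^sup>2] = O(1/k)\<close>. With \<open>u\<^sub>k = \<phi>\<^sub>k + h\<^sub>k\<close>, the functions \<open>\<psi>\<^sub>k = u\<^sub>k - h\<^sub>k\<^sub>+\<^sub>1 \<circ> T\<close>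
  satisfy \<open>P \<psi>\<^sub>k = 0\<close>, so that the \<open>\<psi>\<^sub>k \<circ> T\<^sup>k\<close> are reverse martingale differences whose sum differs from
  that of the \<open>\<phi>\<^sub>k \<circ> T\<^sup>k\<close> by a bounded function. The characteristic function is computed by peeling off one
  \<open>\<psi>\<^sub>k\<close> at a time: to second order this multiplies it by \<open>1 - s\<^sup>2 v\<^sub>k / 2\<close>, where \<open>v\<^sub>k = E[\<psi>\<^sub>k\<^sup>2]\<close>, up to the
  correlations of \<open>u\<^sub>k\<^sup>2\<close> and \<open>h\<^sub>k\<^sub>+\<^sub>1\<^sup>2\<close> with a function of the later terms. These are small by exponential decay,
  in which the \<open>O(1/k)\<close> bounds on the means of the two squares save the logarithms that are lost otherwise.
  Working with \<open>cos (s Z + a)\<close> for all phases \<open>a\<close> keeps everything real.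

  For the variance, a correlation of hits at times \<open>i < k\<close> is at least \<open>-1/(ik)\<close> and at most
  \<open>O(\<theta>\<^sup>k\<^sup>-\<^sup>i/k)\<close> in modulus, which bounds the negative correlations by a summable series; under assumption (C)
  the positive ones with \<open>k - i \<le> log\<^sup>\<kappa> i\<close> are summable as well.
\<close>

section \<open>Functions of bounded variation modulo null sets\<close>

text \<open>The infimum in \<open>ess_variation\<close> need not be attained, so a representative is
  only available up to a slack \<open>e\<close>.\<close>

lemma BV_approx:
  assumes "\<phi> \<in> BV M K" and "0 < e"
  obtains g where "g \<in> borel_measurable M" "AE x in M. g x = \<phi> x"
    "variation K g \<le> ennreal (enn2real (ess_variation M K \<phi>) + e)"
proof -
  have fin: "ess_variation M K \<phi> < \<infinity>"
    using assms by (auto simp: BV_def)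
  then have "ess_variation M K \<phi> = ennreal (enn2real (ess_variation M K \<phi>))"
    by (auto simp: less_top)
  also have "\<dots> < ennreal (enn2real (ess_variation M K \<phi>) + e)"
    using assms by (intro ennreal_lessI) (auto simp: add_nonneg_pos)
  finally obtain g where "g \<in> borel_measurable M" "AE x in M. g x = \<phi> x"
    "variation K g < ennreal (enn2real (ess_variation M K \<phi>) + e)"
    unfolding ess_variation_def by (auto simp: INF_less_iff)
  then show ?thesis using that by (auto simp: less_imp_le)
qed

text \<open>Converse of \<open>BV_approx\<close>. Closure properties of \<open>BV M K\<close> follow
  by applying an operation to near-optimal representatives and letting the slack tend to 0.\<close>

lemma BV_I:
  assumes "integrable M \<phi>" and "0 \<le> v"
    and "\<And>e. 0 < e \<Longrightarrow> \<exists>g\<in>borel_measurable M. (AE x in M. g x = \<phi> x) \<and> variation K g \<le> ennreal (v + e)"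
  shows "\<phi> \<in> BV M K" and "enn2real (ess_variation M K \<phi>) \<le> v"
proof -
  have "ess_variation M K \<phi> \<le> ennreal v + ennreal e" if e: "0 < e" for e
  proof -
    obtain g where "g \<in> borel_measurable M" "AE x in M. g x = \<phi> x" "variation K g \<le> ennreal (v + e)"
      using assms(3)[OF e] by blast
    then have "ess_variation M K \<phi> \<le> ennreal (v + e)"
      unfolding ess_variation_def by (intro INF_lower2) auto
    then show ?thesis using assms(2) e by simp
  qed
  then have le: "ess_variation M K \<phi> \<le> ennreal v"
    by (rule ennreal_le_epsilon)
  then show "\<phi> \<in> BV M K"
    using assms(1) le_less_trans[OF le ennreal_less_top] by (simp add: BV_def)
  show "enn2real (ess_variation M K \<phi>) \<le> v"
    using enn2real_mono[OF le] assms(2) by simp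
qed

text \<open>The hypothesis compares single increments, so the bound holds chain by chain, whatever
  the family \<open>K\<close> is.\<close>

lemma variation_le_combination:
  assumes "0 \<le> a" "0 \<le> b"
    and le: "\<And>x y. \<bar>f x - f y\<bar> \<le> a * \<bar>g x - g y\<bar> + b * \<bar>k x - k y\<bar>"
  shows "variation K f \<le> ennreal a * variation K g + ennreal b * variation K k"
  unfolding variation_def[of K f]
proof (rule SUP_least)
  fix xs assume xs: "xs \<in> K"
  let ?S = "\<lambda>f. \<Sum>i<length xs - 1. ennreal \<bar>f (xs ! Suc i) - f (xs ! i)\<bar>"
  have "?S f \<le> (\<Sum>i<length xs - 1. ennreal a * ennreal \<bar>g (xs ! Suc i) - g (xs ! i)\<bar>
      + ennreal b * ennreal \<bar>k (xs ! Suc i) - k (xs ! i)\<bar>)"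
  proof (rule sum_mono)
    fix i
    show "ennreal \<bar>f (xs ! Suc i) - f (xs ! i)\<bar> \<le> ennreal a * ennreal \<bar>g (xs ! Suc i) - g (xs ! i)\<bar>
      + ennreal b * ennreal \<bar>k (xs ! Suc i) - k (xs ! i)\<bar>"
      using le[of "xs ! Suc i" "xs ! i"] assms(1,2)
      by (simp flip: ennreal_mult ennreal_plus add: ennreal_leI)
  qed
  also have "\<dots> = ennreal a * ?S g + ennreal b * ?S k"
    by (simp add: sum.distrib sum_distrib_left del: sum_ennreal)
  also have "\<dots> \<le> ennreal a * variation K g + ennreal b * variation K k"
    unfolding variation_def using xs by (intro add_mono mult_left_mono SUP_upper) auto
  finally show "?S f \<le> ennreal a * variation K g + ennreal b * variation K k" .
qed

lemma variation_le_scaled: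
  assumes "0 \<le> a" "\<And>x y. \<bar>f x - f y\<bar> \<le> a * \<bar>g x - g y\<bar>"
  shows "variation K f \<le> ennreal a * variation K g"
  using variation_le_combination[of a 0 f g g K] assms by simp

lemma BV_add:
  assumes f: "f \<in> BV M K" and g: "g \<in> BV M K"
  shows "(\<lambda>x. f x + g x) \<in> BV M K"
    and "bv_norm M K (\<lambda>x. f x + g x) \<le> bv_norm M K f + bv_norm M K g"
proof -
  have int: "integrable M f" "integrable M g" using f g by (auto simp: BV_def)
  let ?v = "\<lambda>f. enn2real (ess_variation M K f)"
  have *: "\<exists>k\<in>borel_measurable M. (AE x in M. k x = f x + g x) \<and> variation K k \<le> ennreal ((?v f + ?v g) + e)"
    if e: "0 < e" for e
  proof -
    obtain f' where f': "f' \<in> borel_measurable M" "AE x in M. f' x = f x"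
      "variation K f' \<le> ennreal (?v f + e / 2)"
      using BV_approx[OF f, of "e / 2"] e by auto
    obtain g' where g': "g' \<in> borel_measurable M" "AE x in M. g' x = g x"
      "variation K g' \<le> ennreal (?v g + e / 2)"
      using BV_approx[OF g, of "e / 2"] e by auto
    have "variation K (\<lambda>x. f' x + g' x) \<le> ennreal 1 * variation K f' + ennreal 1 * variation K g'"
      by (rule variation_le_combination) (auto simp: abs_if)
    also have "\<dots> \<le> ennreal (?v f + e / 2) + ennreal (?v g + e / 2)"
      using f'(3) g'(3) by (simp add: add_mono)
    also have "\<dots> = ennreal ((?v f + ?v g) + e)"
      using e by (simp flip: ennreal_plus)
    finally show ?thesis
      using f'(1,2) g'(1,2) by (intro bexI[of _ "\<lambda>x. f' x + g' x"]) auto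
  qed
  show "(\<lambda>x. f x + g x) \<in> BV M K"
    by (rule BV_I(1)[OF _ _ *]) (use int in auto)
  have "?v (\<lambda>x. f x + g x) \<le> ?v f + ?v g"
    by (rule BV_I(2)[OF _ _ *]) (use int in auto)
  moreover have "(\<integral>x. \<bar>f x + g x\<bar> \<partial>M) \<le> (\<integral>x. \<bar>f x\<bar> + \<bar>g x\<bar> \<partial>M)"
    using int by (intro integral_mono) auto
  then have "(\<integral>x. \<bar>f x + g x\<bar> \<partial>M) \<le> (\<integral>x. \<bar>f x\<bar> \<partial>M) + (\<integral>x. \<bar>g x\<bar> \<partial>M)"
    using int by simp
  ultimately show "bv_norm M K (\<lambda>x. f x + g x) \<le> bv_norm M K f + bv_norm M K g"
    by (simp add: bv_norm_def)
qed

lemma variation_const [simp]: "variation K (\<lambda>_. c) = 0"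
  using variation_le_scaled[of 0 "\<lambda>_. c" "\<lambda>_. c" K] by simp

lemma ess_variation_le_variation: "\<phi> \<in> borel_measurable M \<Longrightarrow> ess_variation M K \<phi> \<le> variation K \<phi>"
  unfolding ess_variation_def by (rule INF_lower) auto

lemma (in prob_space) BV_const:
  "(\<lambda>_. c) \<in> BV M K" "bv_norm M K (\<lambda>_. c) = \<bar>c\<bar>"
proof -
  have "ess_variation M K (\<lambda>_. c) = 0"
    using ess_variation_le_variation[of "\<lambda>_. c" M K] by simp
  then show "(\<lambda>_. c) \<in> BV M K" "bv_norm M K (\<lambda>_. c) = \<bar>c\<bar>"
    by (auto simp: BV_def bv_norm_def prob_space)
qed

lemma bv_norm_nonneg: "0 \<le> bv_norm M K \<phi>"
  by (simp add: bv_norm_def)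

lemma (in prob_space) BV_centred:
  assumes f: "f \<in> BV M K"
  shows "(\<lambda>x. f x - (\<integral>x. f x \<partial>M)) \<in> BV M K"
    and "bv_norm M K (\<lambda>x. f x - (\<integral>x. f x \<partial>M)) \<le> 2 * bv_norm M K f"
proof -
  let ?m = "\<integral>x. f x \<partial>M"
  show "(\<lambda>x. f x - ?m) \<in> BV M K"
    using BV_add(1)[OF f BV_const(1)[where c = "- ?m"]] by simp
  have "bv_norm M K (\<lambda>x. f x - ?m) \<le> bv_norm M K f + \<bar>?m\<bar>"
    using BV_add(2)[OF f BV_const(1)[where c = "- ?m"]] by (simp add: BV_const)
  also have "\<bar>?m\<bar> \<le> bv_norm M K f"
    using integral_abs_bound[of M f] L1_le_bv_norm[of M f K] by linarith
  finally show "bv_norm M K (\<lambda>x. f x - ?m) \<le> 2 * bv_norm M K f" by simp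
qed

lemma (in prob_space) BV_sum:
  assumes "finite I" "\<And>i. i \<in> I \<Longrightarrow> f i \<in> BV M K"
  shows "(\<lambda>x. \<Sum>i\<in>I. f i x) \<in> BV M K
    \<and> bv_norm M K (\<lambda>x. \<Sum>i\<in>I. f i x) \<le> (\<Sum>i\<in>I. bv_norm M K (f i))"
  using assms
proof (induction I rule: finite_induct)
  case empty
  show ?case using BV_const[where c = 0] by simp
next
  case (insert i I)
  then show ?case
    using BV_add[of "f i" M K "\<lambda>x. \<Sum>i\<in>I. f i x"] by auto
qed

text \<open>Cutting a representative off at the essential bound \<open>c\<close> does not increase its variation and
  makes squaring \<open>2c\<close>-Lipschitz on its range.\<close>

lemma BV_square:
  assumes f: "f \<in> BV M K" and c: "0 \<le> c" "AE x in M. \<bar>f x\<bar> \<le> c"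
  shows "(\<lambda>x. (f x)\<^sup>2) \<in> BV M K"
    and "bv_norm M K (\<lambda>x. (f x)\<^sup>2) \<le> 2 * c * bv_norm M K f"
proof -
  have int: "integrable M f" using f by (auto simp: BV_def)
  have bound: "AE x in M. (f x)\<^sup>2 \<le> c * \<bar>f x\<bar>"
    using c(2)
  proof eventually_elim
    case (elim x)
    then have "\<bar>f x\<bar> * \<bar>f x\<bar> \<le> c * \<bar>f x\<bar>" by (intro mult_right_mono) auto
    then show ?case by (simp add: power2_eq_square)
  qed
  have int2: "integrable M (\<lambda>x. (f x)\<^sup>2)"
    by (rule Bochner_Integration.integrable_bound[of M "\<lambda>x. c * \<bar>f x\<bar>"])
      (use int bound c in auto)
  let ?v = "enn2real (ess_variation M K f)"
  have *: "\<exists>k\<in>borel_measurable M. (AE x in M. k x = (f x)\<^sup>2) \<and> variation K k \<le> ennreal (2 * c * ?v + e)"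
    if e: "0 < e" for e
  proof -
    \<comment> \<open>The \<open>+ 1\<close> keeps the denominator positive when
      \<open>c = 0\<close>.\<close>
    define d where "d = e / (2 * c + 1)"
    have d: "0 < d" "2 * c * d \<le> e"
      using c e by (auto simp: d_def field_simps)
    obtain g where g: "g \<in> borel_measurable M" "AE x in M. g x = f x"
      "variation K g \<le> ennreal (?v + d)"
      using BV_approx[OF f d(1)] by auto
    define k where "k x = max (- c) (min c (g x))" for x
    have k: "\<bar>k x\<bar> \<le> c" "\<bar>k x - k y\<bar> \<le> \<bar>g x - g y\<bar>" for x y
      using c(1) by (auto simp: k_def)
    have "variation K (\<lambda>x. (k x)\<^sup>2) \<le> ennreal (2 * c) * variation K g"
    proof (rule variation_le_scaled)
      fix x y
      have "\<bar>(k x)\<^sup>2 - (k y)\<^sup>2\<bar> = \<bar>k x + k y\<bar> * \<bar>k x - k y\<bar>"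
        by (simp add: power2_eq_square algebra_simps flip: abs_mult)
      also have "\<dots> \<le> (2 * c) * \<bar>g x - g y\<bar>"
        using k[of x] k[of y] c(1) by (intro mult_mono) auto
      finally show "\<bar>(k x)\<^sup>2 - (k y)\<^sup>2\<bar> \<le> (2 * c) * \<bar>g x - g y\<bar>" .
    qed (use c in auto)
    also have "\<dots> \<le> ennreal (2 * c) * ennreal (?v + d)"
      by (intro mult_left_mono g) auto
    also have "\<dots> = ennreal (2 * c * (?v + d))"
      using c d by (simp add: ennreal_mult)
    also have "\<dots> \<le> ennreal (2 * c * ?v + e)"
      using d by (intro ennreal_leI) (simp add: algebra_simps)
    finally have "variation K (\<lambda>x. (k x)\<^sup>2) \<le> ennreal (2 * c * ?v + e)" .
    moreover have "AE x in M. (k x)\<^sup>2 = (f x)\<^sup>2"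
      using g(2) c(2) by eventually_elim (auto simp: k_def)
    moreover have "(\<lambda>x. (k x)\<^sup>2) \<in> borel_measurable M"
      using g(1) unfolding k_def by measurable
    ultimately show ?thesis by (intro bexI[of _ "\<lambda>x. (k x)\<^sup>2"] conjI)
  qed
  show "(\<lambda>x. (f x)\<^sup>2) \<in> BV M K"
    by (rule BV_I(1)[OF int2 _ *]) (use c in auto)
  have "enn2real (ess_variation M K (\<lambda>x. (f x)\<^sup>2)) \<le> 2 * c * ?v"
    by (rule BV_I(2)[OF int2 _ *]) (use c in auto)
  moreover have "(\<integral>x. \<bar>(f x)\<^sup>2\<bar> \<partial>M) \<le> (\<integral>x. c * \<bar>f x\<bar> \<partial>M)"
    using int int2 bound by (intro integral_mono_AE) auto
  \<comment> \<open>The factor \<open>c\<close> suffices for this part; it is doubled so that both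
    parts of the norm carry \<open>2 * c\<close>.\<close>
  then have "(\<integral>x. \<bar>(f x)\<^sup>2\<bar> \<partial>M) \<le> c * (\<integral>x. \<bar>f x\<bar> \<partial>M) + c * (\<integral>x. \<bar>f x\<bar> \<partial>M)"
    using mult_nonneg_nonneg[OF c(1), of "\<integral>x. \<bar>f x\<bar> \<partial>M"] by simp
  then have "(\<integral>x. \<bar>(f x)\<^sup>2\<bar> \<partial>M) \<le> 2 * c * (\<integral>x. \<bar>f x\<bar> \<partial>M)"
    by linarith
  ultimately show "bv_norm M K (\<lambda>x. (f x)\<^sup>2) \<le> 2 * c * bv_norm M K f"
    by (simp add: bv_norm_def distrib_left)
qed

section \<open>Bounded functions and decay of correlations\<close>

text \<open>Only membership is recorded; numerical bounds are stated separately as \<open>AE\<close>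
  facts. On a probability space members are integrable and lie in \<open>L2 M\<close>, so one set of
  closure rules settles the side conditions of all integral manipulations below.\<close>

definition Linf :: "'a measure \<Rightarrow> ('a \<Rightarrow> real) set" where
  "Linf M = {f \<in> borel_measurable M. \<exists>c. AE x in M. \<bar>f x\<bar> \<le> c}"

lemma LinfI: "f \<in> borel_measurable M \<Longrightarrow> AE x in M. \<bar>f x\<bar> \<le> c \<Longrightarrow> f \<in> Linf M"
  by (auto simp: Linf_def)

lemma LinfE:
  assumes "f \<in> Linf M"
  obtains c where "0 \<le> c" "AE x in M. \<bar>f x\<bar> \<le> c"
proof -
  obtain c where "AE x in M. \<bar>f x\<bar> \<le> c" using assms by (auto simp: Linf_def)
  then have "AE x in M. \<bar>f x\<bar> \<le> max 0 c" by eventually_elim auto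
  then show ?thesis using that[of "max 0 c"] by simp
qed

lemma Linf_measurable: "f \<in> Linf M \<Longrightarrow> f \<in> borel_measurable M"
  by (auto simp: Linf_def)

named_theorems Linf_intros

lemma Linf_const [Linf_intros]: "(\<lambda>_. c) \<in> Linf M"
  by (rule LinfI[of _ _ "\<bar>c\<bar>"]) auto

lemma Linf_cos [Linf_intros]: "f \<in> borel_measurable M \<Longrightarrow> (\<lambda>x. cos (f x)) \<in> Linf M"
  by (rule LinfI[of _ _ 1]) auto

lemma Linf_sin [Linf_intros]: "f \<in> borel_measurable M \<Longrightarrow> (\<lambda>x. sin (f x)) \<in> Linf M"
  by (rule LinfI[of _ _ 1]) auto

lemma Linf_add [Linf_intros]:
  assumes "f \<in> Linf M" "g \<in> Linf M"
  shows "(\<lambda>x. f x + g x) \<in> Linf M"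
proof -
  note [measurable] = assms[THEN Linf_measurable]
  obtain a b where ab: "AE x in M. \<bar>f x\<bar> \<le> a" "AE x in M. \<bar>g x\<bar> \<le> b"
    using assms by (auto simp: Linf_def)
  from ab have "AE x in M. \<bar>f x + g x\<bar> \<le> a + b" by eventually_elim auto
  then show ?thesis by (intro LinfI[of _ _ "a + b"]) measurable
qed

lemma Linf_mult [Linf_intros]:
  assumes "f \<in> Linf M" "g \<in> Linf M"
  shows "(\<lambda>x. f x * g x) \<in> Linf M"
proof -
  note [measurable] = assms[THEN Linf_measurable]
  obtain a where a: "0 \<le> a" "AE x in M. \<bar>f x\<bar> \<le> a" using assms(1) by (rule LinfE)
  obtain b where b: "AE x in M. \<bar>g x\<bar> \<le> b" using assms(2) by (auto simp: Linf_def)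
  from a(2) b have "AE x in M. \<bar>f x * g x\<bar> \<le> a * b"
    by eventually_elim (use a(1) in \<open>auto simp: abs_mult intro!: mult_mono\<close>)
  then show ?thesis by (intro LinfI[of _ _ "a * b"]) measurable
qed

lemma Linf_minus [Linf_intros]: "f \<in> Linf M \<Longrightarrow> (\<lambda>x. - f x) \<in> Linf M"
  by (auto simp: Linf_def)

lemma Linf_abs [Linf_intros]: "f \<in> Linf M \<Longrightarrow> (\<lambda>x. \<bar>f x\<bar>) \<in> Linf M"
  by (auto simp: Linf_def)

lemma Linf_diff [Linf_intros]: "f \<in> Linf M \<Longrightarrow> g \<in> Linf M \<Longrightarrow> (\<lambda>x. f x - g x) \<in> Linf M"
  using Linf_add[OF _ Linf_minus, of f M g] by simp

lemma Linf_power [Linf_intros]: "f \<in> Linf M \<Longrightarrow> (\<lambda>x. f x ^ n) \<in> Linf M"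
  by (induction n) (auto intro: Linf_intros)

lemma Linf_sum [Linf_intros]:
  "(\<And>i. i \<in> I \<Longrightarrow> f i \<in> Linf M) \<Longrightarrow> (\<lambda>x. \<Sum>i\<in>I. f i x) \<in> Linf M"
  by (induction I rule: infinite_finite_induct) (auto intro: Linf_intros)

lemma Linf_indicator [Linf_intros]: "A \<in> sets M \<Longrightarrow> indicator A \<in> Linf M"
  by (rule LinfI[of _ _ 1]) (auto simp: indicator_def)

lemma (in prob_space) Linf_integrable [Linf_intros]: "f \<in> Linf M \<Longrightarrow> integrable M f"
  by (auto simp: Linf_def intro!: integrable_const_bound)

lemma (in prob_space) Linf_L2 [Linf_intros]: "f \<in> Linf M \<Longrightarrow> f \<in> L2 M"
  by (auto simp: L2_def intro!: Linf_intros Linf_measurable)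

lemma (in prob_space) integral_le_AE_bound:
  "f \<in> borel_measurable M \<Longrightarrow> AE x in M. \<bar>f x\<bar> \<le> c \<Longrightarrow> (\<integral>x. \<bar>f x\<bar> \<partial>M) \<le> (c::real)"
  using integral_mono_AE[of M "\<lambda>x. \<bar>f x\<bar>" "\<lambda>_. c"] Linf_integrable[OF Linf_abs[OF LinfI[of f M c]]]
  by (simp add: prob_space)

lemma abs_integral_mult_le:
  assumes "integrable M (\<lambda>x. g x * f x)" "integrable M g" "AE x in M. \<bar>f x\<bar> \<le> (c::real)"
  shows "\<bar>\<integral>x. g x * f x \<partial>M\<bar> \<le> c * (\<integral>x. \<bar>g x\<bar> \<partial>M)"
proof -
  have "\<bar>\<integral>x. g x * f x \<partial>M\<bar> \<le> (\<integral>x. \<bar>g x * f x\<bar> \<partial>M)"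
    by (rule integral_abs_bound)
  also have "\<dots> \<le> (\<integral>x. c * \<bar>g x\<bar> \<partial>M)"
  proof (rule integral_mono_AE)
    show "AE x in M. \<bar>g x * f x\<bar> \<le> c * \<bar>g x\<bar>"
      using assms(3) by eventually_elim (auto simp: abs_mult mult.commute intro: mult_right_mono)
  qed (use assms in auto)
  finally show ?thesis using assms by simp
qed

section \<open>Measure-preserving maps and duality with the transfer operator\<close>

locale transfer_system = prob_space M for M :: "'a measure" +
  fixes T :: "'a \<Rightarrow> 'a" and P :: "('a \<Rightarrow> real) \<Rightarrow> ('a \<Rightarrow> real)"
  assumes T_measurable [measurable]: "T \<in> measurable M M"
    and T_preserves: "distr M M T = M"
    and transfer: "transfer_operator M T P"
begin

lemma T_pow_measurable [measurable]: "T ^^ n \<in> measurable M M"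
  by (induction n) (auto intro: measurable_comp)

lemma T_pow_preserves: "distr M M (T ^^ n) = M"
proof (induction n)
  case 0
  show ?case by (simp add: distr_id2)
next
  case (Suc n)
  have "distr M M (T ^^ Suc n) = distr (distr M M (T ^^ n)) M T"
    by (subst distr_distr) auto
  then show ?case using Suc T_preserves by (simp del: funpow.simps)
qed

lemma AE_T_pow: "AE x in M. Q x \<Longrightarrow> AE x in M. Q ((T ^^ n) x)"
  using AE_distrD[OF T_pow_measurable, of Q n] unfolding T_pow_preserves .

lemma AE_T: "AE x in M. Q x \<Longrightarrow> AE x in M. Q (T x)"
  using AE_T_pow[of Q 1] by simp

lemma integral_T_pow: "f \<in> borel_measurable M \<Longrightarrow> (\<integral>x. f ((T ^^ n) x) \<partial>M) = (\<integral>x. f x \<partial>M :: real)"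
  using integral_distr[OF T_pow_measurable, of f n] by (simp add: T_pow_preserves)

lemma integral_T: "f \<in> borel_measurable M \<Longrightarrow> (\<integral>x. f (T x) \<partial>M) = (\<integral>x. f x \<partial>M :: real)"
  using integral_T_pow[of f 1] by simp

text \<open>Invariance of the measure makes preimages of null sets null, so essential bounds survive
  composition.\<close>

lemma Linf_T_pow [Linf_intros]:
  assumes "f \<in> Linf M" shows "(\<lambda>x. f ((T ^^ n) x)) \<in> Linf M"
proof -
  obtain c where "AE x in M. \<bar>f x\<bar> \<le> c" using assms by (auto simp: Linf_def)
  then have "AE x in M. \<bar>f ((T ^^ n) x)\<bar> \<le> c" by (rule AE_T_pow)
  moreover note [measurable] = Linf_measurable[OF assms]
  ultimately show ?thesis by (intro LinfI[of _ _ c]) measurable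
qed

lemma Linf_T [Linf_intros]: "f \<in> Linf M \<Longrightarrow> (\<lambda>x. f (T x)) \<in> Linf M"
  using Linf_T_pow[of f 1] by simp

lemma L2_T:
  assumes "f \<in> L2 M" shows "(\<lambda>x. f (T x)) \<in> L2 M"
proof -
  have f: "f \<in> borel_measurable M" "integrable M (\<lambda>x. (f x)\<^sup>2)"
    using assms by (auto simp: L2_def)
  then have "integrable (distr M M T) (\<lambda>x. (f x)\<^sup>2)" by (simp add: T_preserves)
  then have "integrable M (\<lambda>x. (f (T x))\<^sup>2)"
    by (subst (asm) integrable_distr_eq) (use f in auto)
  then show ?thesis using f by (auto simp: L2_def)
qed

lemma transfer_pow:
  assumes "\<phi> \<in> L2 M"
  shows "(P ^^ n) \<phi> \<in> L2 M"
    and "\<psi> \<in> L2 M \<Longrightarrow> (\<integral>x. \<phi> x * \<psi> ((T ^^ n) x) \<partial>M) = (\<integral>x. (P ^^ n) \<phi> x * \<psi> x \<partial>M)"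
proof (induction n arbitrary: \<psi>)
  case (Suc n)
  { case 1 show ?case using Suc(1) transfer by (auto simp: transfer_operator_def) }
  { case 2
    have "(\<integral>x. \<phi> x * \<psi> ((T ^^ Suc n) x) \<partial>M) = (\<integral>x. (P ^^ n) \<phi> x * \<psi> (T x) \<partial>M)"
      using Suc(2)[OF L2_T[OF 2]] by simp
    also have "\<dots> = (\<integral>x. P ((P ^^ n) \<phi>) x * \<psi> x \<partial>M)"
      using Suc(1) 2 transfer by (auto simp: transfer_operator_def)
    finally show ?case by simp }
qed (use assms in auto)

text \<open>Test the duality against the sign of \<open>(P ^^ n) \<phi>\<close>, a function bounded
  by 1.\<close>

lemma transfer_pow_L1:
  assumes "\<phi> \<in> Linf M" "(P ^^ n) \<phi> \<in> Linf M"
  shows "(\<integral>x. \<bar>(P ^^ n) \<phi> x\<bar> \<partial>M) \<le> (\<integral>x. \<bar>\<phi> x\<bar> \<partial>M)"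
proof -
  let ?s = "\<lambda>x. sgn ((P ^^ n) \<phi> x)"
  have [measurable]: "(P ^^ n) \<phi> \<in> borel_measurable M" using assms(2) by (rule Linf_measurable)
  have s: "?s \<in> Linf M"
    by (rule LinfI[of _ _ 1]) (auto simp: sgn_if)
  have "(\<integral>x. \<bar>(P ^^ n) \<phi> x\<bar> \<partial>M) = (\<integral>x. (P ^^ n) \<phi> x * ?s x \<partial>M)"
    by (simp add: abs_sgn)
  also have "\<dots> = (\<integral>x. \<phi> x * ?s ((T ^^ n) x) \<partial>M)"
    using transfer_pow(2)[of \<phi> ?s n] assms s by (simp add: Linf_L2)
  also have "\<dots> \<le> 1 * (\<integral>x. \<bar>\<phi> x\<bar> \<partial>M)"
    by (rule order_trans[OF abs_ge_self abs_integral_mult_le])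
      (use assms s in \<open>auto intro!: Linf_intros simp: sgn_if\<close>)
  finally show ?thesis by simp
qed

end

text \<open>A single \<open>C\<close> serves as the constant of the sup bound and of the
  contraction; \<open>1 \<le> C\<close> allows a power of \<open>C\<close> to be replaced by a
  higher one.\<close>

locale bv_contraction = transfer_system M T P for M :: "'a measure" and T P +
  fixes K :: "'a list set" and C \<theta> :: real
  assumes C_ge_1: "1 \<le> C" and \<theta>: "0 < \<theta>" "\<theta> < 1"
    and BV_sup: "\<phi> \<in> BV M K \<Longrightarrow> AE x in M. \<bar>\<phi> x\<bar> \<le> C * bv_norm M K \<phi>"
    and BV_contraction: "\<phi> \<in> BV M K \<Longrightarrow> (\<integral>x. \<phi> x \<partial>M) = 0 \<Longrightarrow>
      (P ^^ n) \<phi> \<in> BV M K \<and> bv_norm M K ((P ^^ n) \<phi>) \<le> C * \<theta> ^ n * bv_norm M K \<phi>"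
begin

lemma BV_Linf: "\<phi> \<in> BV M K \<Longrightarrow> \<phi> \<in> Linf M"
  using BV_sup by (intro LinfI[of _ _ "C * bv_norm M K \<phi>"]) (auto simp: BV_def)

lemma transfer_pow_sup:
  assumes "\<phi> \<in> BV M K" "(\<integral>x. \<phi> x \<partial>M) = 0"
  shows "AE x in M. \<bar>(P ^^ n) \<phi> x\<bar> \<le> C\<^sup>2 * \<theta> ^ n * bv_norm M K \<phi>"
proof -
  have *: "(P ^^ n) \<phi> \<in> BV M K" "bv_norm M K ((P ^^ n) \<phi>) \<le> C * \<theta> ^ n * bv_norm M K \<phi>"
    using BV_contraction[OF assms] by auto
  have "C * bv_norm M K ((P ^^ n) \<phi>) \<le> C * (C * \<theta> ^ n * bv_norm M K \<phi>)"
    using *(2) C_ge_1 by (intro mult_left_mono) auto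
  then have "C * bv_norm M K ((P ^^ n) \<phi>) \<le> C\<^sup>2 * \<theta> ^ n * bv_norm M K \<phi>"
    by (simp add: power2_eq_square mult_ac)
  with BV_sup[OF *(1)] show ?thesis by (auto elim: eventually_mono)
qed

text \<open>Centre \<open>q\<close>, move \<open>T ^^ n\<close> onto it as \<open>P ^^ n\<close>,
  and pair the sup norm of the result with the \<open>L1\<close> norm of \<open>G\<close>. Having
  the \<open>L1\<close> norm on the right is essential: for a target function of index
  \<open>k\<close> it supplies an extra factor of order \<open>1/k\<close>.\<close>

lemma decay_of_correlations:
  assumes q: "q \<in> BV M K" and G: "G \<in> Linf M"
  shows "\<bar>(\<integral>x. q x * G ((T ^^ n) x) \<partial>M) - (\<integral>x. q x \<partial>M) * (\<integral>x. G x \<partial>M)\<bar>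
    \<le> 2 * C\<^sup>2 * \<theta> ^ n * bv_norm M K q * (\<integral>x. \<bar>G x\<bar> \<partial>M)"
proof -
  define m where "m = (\<integral>x. q x \<partial>M)"
  define f where "f x = q x - m" for x
  have qL: "q \<in> Linf M" using q by (rule BV_Linf)
  have f: "f \<in> BV M K" "bv_norm M K f \<le> 2 * bv_norm M K q" "(\<integral>x. f x \<partial>M) = 0"
    using BV_centred[OF q] qL
    by (auto simp: f_def[abs_def] m_def prob_space Linf_integrable)
  have fL: "f \<in> Linf M" using f(1) by (rule BV_Linf)
  have PL: "(P ^^ n) f \<in> Linf M" using BV_contraction[OF f(1,3)] by (blast intro: BV_Linf)
  have "(\<integral>x. q x * G ((T ^^ n) x) \<partial>M) - m * (\<integral>x. G x \<partial>M)
      = (\<integral>x. q x * G ((T ^^ n) x) \<partial>M) - (\<integral>x. m * G ((T ^^ n) x) \<partial>M)"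
    using G integral_T_pow[of G n] by (auto dest: Linf_measurable)
  also have "\<dots> = (\<integral>x. f x * G ((T ^^ n) x) \<partial>M)"
    unfolding f_def left_diff_distrib
    by (rule Bochner_Integration.integral_diff[symmetric]) (auto intro!: Linf_intros qL G)
  also have "\<dots> = (\<integral>x. G x * (P ^^ n) f x \<partial>M)"
    using transfer_pow(2)[OF Linf_L2[OF fL] Linf_L2[OF G], of n] by (simp add: mult.commute)
  finally have "\<bar>(\<integral>x. q x * G ((T ^^ n) x) \<partial>M) - m * (\<integral>x. G x \<partial>M)\<bar>
      \<le> (C\<^sup>2 * \<theta> ^ n * bv_norm M K f) * (\<integral>x. \<bar>G x\<bar> \<partial>M)"
    using abs_integral_mult_le[of M G "(P ^^ n) f", OF _ _ transfer_pow_sup[OF f(1,3)]] G PL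
    by (auto intro!: Linf_intros)
  also have "\<dots> \<le> (C\<^sup>2 * \<theta> ^ n * (2 * bv_norm M K q)) * (\<integral>x. \<bar>G x\<bar> \<partial>M)"
    using f(2) \<theta> by (intro mult_right_mono mult_left_mono) auto
  finally show ?thesis by (simp add: m_def mult_ac)
qed

end

section \<open>The martingale approximation\<close>

lemma sum_weighted_geometric_le:
  fixes \<rho> :: real
  assumes "0 \<le> \<rho>" "\<rho> < 1"
  shows "(\<Sum>r<n. (1 + real r) * \<rho> ^ r) \<le> 1 / (1 - \<rho>)\<^sup>2"
proof -
  have "(\<lambda>n. of_nat (Suc n) * \<rho> ^ n) sums (1 / (1 - \<rho>)\<^sup>2)"
    using assms by (intro geometric_deriv_sums) auto
  then have "(\<lambda>r. (1 + real r) * \<rho> ^ r) sums (1 / (1 - \<rho>)\<^sup>2)" by simp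
  then show ?thesis
    using assms sum_le_suminf[of "\<lambda>r. (1 + real r) * \<rho> ^ r" "{..<n}"] by (auto simp: sums_iff)
qed

lemma sum_weighted_geometric_diff_le:
  fixes \<rho> :: real
  assumes "0 \<le> \<rho>" "\<rho> < 1"
  shows "(\<Sum>j=1..<k. (1 + real (k - j)) * \<rho> ^ (k - j)) \<le> 1 / (1 - \<rho>)\<^sup>2"
proof -
  have "(\<Sum>j=1..<k. (1 + real (k - j)) * \<rho> ^ (k - j)) = (\<Sum>r=1..<k. (1 + real r) * \<rho> ^ r)"
    by (rule sum.reindex_bij_witness[of _ "\<lambda>r. k - r" "\<lambda>j. k - j"]) auto
  also have "\<dots> \<le> (\<Sum>r<k. (1 + real r) * \<rho> ^ r)"
    using assms by (intro sum_mono2) auto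
  also have "\<dots> \<le> 1 / (1 - \<rho>)\<^sup>2" by (rule sum_weighted_geometric_le[OF assms])
  finally show ?thesis .
qed

text \<open>Injectivity makes the exponents distinct. The bound is that of the weighted series,
  cruder than \<open>1 / (1 - \<rho>)\<close>, so that one constant covers both kinds of
  sum.\<close>

lemma sum_geometric_le:
  fixes \<rho> :: real
  assumes "0 \<le> \<rho>" "\<rho> < 1" "finite I" "inj_on f I"
  shows "(\<Sum>i\<in>I. \<rho> ^ f i) \<le> 1 / (1 - \<rho>)\<^sup>2"
proof -
  obtain n where n: "f ` I \<subseteq> {..<n}"
    using finite_nat_bounded[OF finite_imageI[OF assms(3)], of f] by blast
  have "(\<Sum>i\<in>I. \<rho> ^ f i) = (\<Sum>r\<in>f ` I. \<rho> ^ r)"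
    using assms(4) by (simp add: sum.reindex)
  also have "\<dots> \<le> (\<Sum>r<n. \<rho> ^ r)"
    using n assms by (intro sum_mono2) auto
  also have "\<dots> \<le> (\<Sum>r<n. (1 + real r) * \<rho> ^ r)"
    using assms by (intro sum_mono) (simp add: distrib_right)
  also have "\<dots> \<le> 1 / (1 - \<rho>)\<^sup>2" by (rule sum_weighted_geometric_le[OF assms(1,2)])
  finally show ?thesis .
qed

text \<open>Used to trade \<open>1/j\<close> for \<open>1/k\<close> at the price of the weight
  \<open>1 + (k - j)\<close>, which a geometric factor absorbs.\<close>

lemma le_mult_Suc_diff: "1 \<le> j \<Longrightarrow> j < k \<Longrightarrow> real k \<le> real j * (1 + real (k - j))"
proof -
  assume *: "1 \<le> j" "j < k"
  then have "1 * real (k - j) \<le> real j * real (k - j)" by (intro mult_right_mono) auto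
  moreover have "real k = real j + real (k - j)" using * by simp
  ultimately show ?thesis by (simp only: distrib_left)
qed

lemma sum_geometric_div_le:
  fixes \<rho> :: real
  assumes "0 \<le> \<rho>" "\<rho> < 1"
  shows "(\<Sum>j=1..<k. \<rho> ^ (k - j) / real j) \<le> 1 / (1 - \<rho>)\<^sup>2 / real k"
proof -
  have "(\<Sum>j=1..<k. \<rho> ^ (k - j) / real j) \<le> (\<Sum>j=1..<k. (1 + real (k - j)) * \<rho> ^ (k - j) / real k)"
  proof (rule sum_mono)
    fix j assume j: "j \<in> {1..<k}"
    then have "\<rho> ^ (k - j) * real k \<le> \<rho> ^ (k - j) * (real j * (1 + real (k - j)))"
      using assms by (intro mult_left_mono le_mult_Suc_diff) auto
    then show "\<rho> ^ (k - j) / real j \<le> (1 + real (k - j)) * \<rho> ^ (k - j) / real k"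
      using j by (simp add: field_simps)
  qed
  also have "\<dots> \<le> 1 / (1 - \<rho>)\<^sup>2 / real k"
    using sum_weighted_geometric_diff_le[OF assms, of k]
    unfolding sum_divide_distrib[symmetric] by (rule divide_right_mono) simp
  finally show ?thesis .
qed

text \<open>Each product of two terms is charged to its larger index; counting the diagonal twice is
  harmless.\<close>

lemma square_sum_le:
  fixes a :: "nat \<Rightarrow> real"
  shows "(\<Sum>i=1..<k. a i)\<^sup>2 \<le> 2 * (\<Sum>i=1..<k. \<bar>a i\<bar> * (\<Sum>j=1..i. \<bar>a j\<bar>))"
proof (induction k)
  case (Suc k)
  show ?case
  proof (cases "k = 0")
    case False
    let ?s = "\<Sum>i=1..<k. a i" and ?t = "\<Sum>j=1..<k. \<bar>a j\<bar>"
    have t: "(\<Sum>j=1..k. \<bar>a j\<bar>) = ?t + \<bar>a k\<bar>"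
      using False by (cases k) (auto simp: atLeastLessThanSuc_atLeastAtMost)
    have "?s * a k \<le> \<bar>?s\<bar> * \<bar>a k\<bar>"
      by (metis abs_ge_self abs_mult)
    also have "\<dots> \<le> ?t * \<bar>a k\<bar>"
      by (intro mult_right_mono sum_abs) auto
    finally have st: "?s * a k \<le> ?t * \<bar>a k\<bar>" .
    have "(\<Sum>i=1..<Suc k. a i)\<^sup>2 = ?s\<^sup>2 + 2 * (?s * a k) + a k * a k"
      using False by (simp add: power2_eq_square algebra_simps)
    also have "\<dots> \<le> ?s\<^sup>2 + 2 * (\<bar>a k\<bar> * (?t + \<bar>a k\<bar>))"
    proof -
      have "a k * a k = \<bar>a k\<bar> * \<bar>a k\<bar>" "0 \<le> \<bar>a k\<bar> * \<bar>a k\<bar>" by auto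
      with st show ?thesis by (simp only: distrib_left mult.commute[of "\<bar>a k\<bar>" ?t])
    qed
    finally show ?thesis
      using Suc False t by (simp add: distrib_left)
  qed simp
qed simp

section \<open>Shrinking targets and the correctors \<open>h\<close>\<close>

locale shrinking_targets = bv_contraction M T P K C \<theta>
  for M :: "'a measure" and T P and K :: "'a list set" and C \<theta> :: real +
  fixes B :: "nat \<Rightarrow> 'a set" and b :: real
  assumes B_nested: "1 \<le> i \<Longrightarrow> B (Suc i) \<subseteq> B i"
    and B_measure: "1 \<le> i \<Longrightarrow> measure M (B i) = 1 / real i"
    and B_BV: "1 \<le> i \<Longrightarrow> indicator (B i) \<in> BV M K"
    and B_bv_norm: "1 \<le> i \<Longrightarrow> bv_norm M K (indicator (B i)) \<le> b"
begin

lemma b_nonneg: "0 \<le> b"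
  using B_bv_norm[of 1] bv_norm_nonneg[of M K "indicator (B 1)"] by simp

text \<open>\<open>measure\<close> is 0 outside \<open>sets M\<close>, whereas
  \<open>1 / real i\<close> is positive. The set \<open>B 0\<close> is unconstrained, hence the
  lower bound on indices here and below.\<close>

lemma B_sets: "1 \<le> i \<Longrightarrow> B i \<in> sets M"
  using B_measure[of i] measure_notin_sets[of "B i" M] by fastforce

definition \<phi> :: "nat \<Rightarrow> 'a \<Rightarrow> real" where
  "\<phi> i x = indicator (B i) x - 1 / real i"

text \<open>The recursion \<open>h (Suc k) = P (u k)\<close> in unrolled form. The operator
  \<open>P\<close> acts linearly only up to null sets, whereas the sum is a definite representative;
  the recursion reappears in weak form as \<open>u_dual\<close>.\<close>

definition h :: "nat \<Rightarrow> 'a \<Rightarrow> real" where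
  "h k x = (\<Sum>j=1..<k. (P ^^ (k - j)) (\<phi> j) x)"

definition u :: "nat \<Rightarrow> 'a \<Rightarrow> real" where
  "u k x = \<phi> k x + h k x"

definition \<psi> :: "nat \<Rightarrow> 'a \<Rightarrow> real" where
  "\<psi> k x = u k x - h (Suc k) (T x)"

text \<open>\<open>G\<close> bounds all geometric sums in \<open>\<theta>\<close>, \<open>H\<close>
  bounds both the variation norm and the essential supremum of each \<open>h k\<close>, and
  \<open>H2 / real k\<close> bounds the second moment of \<open>h k\<close>.\<close>

definition G :: real where
  "G = 1 / (1 - \<theta>)\<^sup>2"

definition H :: real where
  "H = 2 * C\<^sup>2 * b * G"

definition H2 :: real where
  "H2 = 4 * H * G"

lemma G_nonneg: "0 \<le> G" by (simp add: G_def)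
lemma H_nonneg: "0 \<le> H" using b_nonneg G_nonneg by (simp add: H_def)
lemma H2_nonneg: "0 \<le> H2" using H_nonneg G_nonneg by (simp add: H2_def)

context
  fixes i :: nat
  assumes i: "1 \<le> i"
begin

lemma indicator_Linf: "indicator (B i) \<in> Linf M"
  using B_sets[OF i] by (rule Linf_indicator)

lemma B_Int_space: "B i \<inter> space M = B i"
  using B_sets[OF i] sets.sets_into_space by blast

lemma \<phi>_BV: "\<phi> i \<in> BV M K" "bv_norm M K (\<phi> i) \<le> 2 * b"
  using BV_centred[OF B_BV[OF i]] B_bv_norm[OF i] by (auto simp: \<phi>_def[abs_def] B_Int_space B_measure[OF i])

lemma \<phi>_Linf: "\<phi> i \<in> Linf M"
  using \<phi>_BV(1) by (rule BV_Linf)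

lemma integral_\<phi>: "(\<integral>x. \<phi> i x \<partial>M) = 0"
  using Linf_integrable[OF indicator_Linf]
  by (simp add: \<phi>_def[abs_def] B_Int_space B_measure[OF i] prob_space)

lemma \<phi>_abs_le: "\<bar>\<phi> i x\<bar> \<le> 1"
  using i by (auto simp: \<phi>_def indicator_def field_simps)

lemma integral_abs_\<phi>: "(\<integral>x. \<bar>\<phi> i x\<bar> \<partial>M) \<le> 2 / real i"
proof -
  have "(\<integral>x. \<bar>\<phi> i x\<bar> \<partial>M) \<le> (\<integral>x. indicator (B i) x + 1 / real i \<partial>M)"
  proof (rule integral_mono)
    show "\<bar>\<phi> i x\<bar> \<le> indicator (B i) x + 1 / real i" for x
      using abs_triangle_ineq4[of "indicator (B i) x" "1 / real i"] by (simp add: \<phi>_def)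
  qed (intro Linf_intros \<phi>_Linf indicator_Linf)+
  also have "\<dots> = 2 / real i"
    using Linf_integrable[OF indicator_Linf] by (simp add: B_Int_space B_measure[OF i] prob_space)
  finally show ?thesis .
qed

lemma integral_\<phi>_square: "(\<integral>x. (\<phi> i x)\<^sup>2 \<partial>M) = 1 / real i - 1 / (real i)\<^sup>2"
proof -
  have eq: "(\<phi> i x)\<^sup>2 = indicator (B i) x * (1 - 2 / real i) + 1 / (real i)\<^sup>2" for x
    by (auto simp: \<phi>_def indicator_def power2_eq_square algebra_simps)
  show ?thesis
    unfolding eq using i Linf_integrable[OF indicator_Linf]
    by (simp add: B_Int_space B_measure[OF i] prob_space power2_eq_square field_simps)
qed

lemma transfer_\<phi>_BV: "(P ^^ n) (\<phi> i) \<in> BV M K" "bv_norm M K ((P ^^ n) (\<phi> i)) \<le> 2 * C\<^sup>2 * b * \<theta> ^ n"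
proof -
  have *: "(P ^^ n) (\<phi> i) \<in> BV M K" "bv_norm M K ((P ^^ n) (\<phi> i)) \<le> C * \<theta> ^ n * bv_norm M K (\<phi> i)"
    using BV_contraction[OF \<phi>_BV(1) integral_\<phi>] by auto
  note *(2)
  also have "C * \<theta> ^ n * bv_norm M K (\<phi> i) \<le> C * \<theta> ^ n * (2 * b)"
    using C_ge_1 \<theta> \<phi>_BV(2) by (intro mult_left_mono) auto
  \<comment> \<open>One factor \<open>C\<close> is given away so that the variation norm and the sup
    norm of these functions have the same bound.\<close>
  also have "\<dots> \<le> C\<^sup>2 * (\<theta> ^ n * (2 * b))"
    unfolding mult.assoc using C_ge_1 \<theta> b_nonneg by (intro mult_right_mono) (auto simp: power2_eq_square)
  finally show "bv_norm M K ((P ^^ n) (\<phi> i)) \<le> 2 * C\<^sup>2 * b * \<theta> ^ n"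
    by (simp add: mult_ac)
  show "(P ^^ n) (\<phi> i) \<in> BV M K" by (rule *)
qed

lemma transfer_\<phi>_Linf: "(P ^^ n) (\<phi> i) \<in> Linf M"
  using transfer_\<phi>_BV(1) by (rule BV_Linf)

lemma transfer_\<phi>_sup: "AE x in M. \<bar>(P ^^ n) (\<phi> i) x\<bar> \<le> 2 * C\<^sup>2 * b * \<theta> ^ n"
proof -
  have "C\<^sup>2 * \<theta> ^ n * bv_norm M K (\<phi> i) \<le> C\<^sup>2 * \<theta> ^ n * (2 * b)"
    using \<theta> \<phi>_BV(2) by (intro mult_left_mono) auto
  with transfer_pow_sup[OF \<phi>_BV(1) integral_\<phi>, of n] show ?thesis
    by (auto elim!: eventually_mono simp: mult_ac)
qed

end

lemma sum_\<theta>_diff_le: "(\<Sum>j=1..<k. \<theta> ^ (k - j)) \<le> G"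
  unfolding G_def using \<theta> by (intro sum_geometric_le) (auto simp: inj_on_def)

lemma h_BV: "h k \<in> BV M K" "bv_norm M K (h k) \<le> H"
proof -
  have *: "h k \<in> BV M K \<and> bv_norm M K (h k) \<le> (\<Sum>j=1..<k. bv_norm M K ((P ^^ (k - j)) (\<phi> j)))"
    unfolding h_def[abs_def] by (intro BV_sum transfer_\<phi>_BV) auto
  then show "h k \<in> BV M K" by auto
  note *[THEN conjunct2]
  also have "(\<Sum>j=1..<k. bv_norm M K ((P ^^ (k - j)) (\<phi> j))) \<le> (\<Sum>j=1..<k. 2 * C\<^sup>2 * b * \<theta> ^ (k - j))"
    by (intro sum_mono transfer_\<phi>_BV) auto
  also have "\<dots> \<le> H"
    unfolding H_def sum_distrib_left[symmetric]
    using b_nonneg by (intro mult_left_mono sum_\<theta>_diff_le) auto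
  finally show "bv_norm M K (h k) \<le> H" .
qed

lemma h_Linf: "h k \<in> Linf M"
  using h_BV(1) by (rule BV_Linf)

lemma AE_transfer_\<phi>_sup: "AE x in M. \<forall>j\<in>{1..<k}. \<bar>(P ^^ (k - j)) (\<phi> j) x\<bar> \<le> 2 * C\<^sup>2 * b * \<theta> ^ (k - j)"
  by (intro AE_finite_allI transfer_\<phi>_sup) auto

text \<open>The sup bounds of the summands are added directly; passing from \<open>h_BV\<close>
  through \<open>BV_sup\<close> would cost another factor \<open>C\<close>.\<close>

lemma h_sup: "AE x in M. \<bar>h k x\<bar> \<le> H"
  using AE_transfer_\<phi>_sup[of k]
proof eventually_elim
  case (elim x)
  have "\<bar>h k x\<bar> \<le> (\<Sum>j=1..<k. \<bar>(P ^^ (k - j)) (\<phi> j) x\<bar>)"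
    unfolding h_def by (rule sum_abs)
  also have "\<dots> \<le> (\<Sum>j=1..<k. 2 * C\<^sup>2 * b * \<theta> ^ (k - j))"
    using elim by (intro sum_mono) auto
  also have "\<dots> \<le> H"
    unfolding H_def sum_distrib_left[symmetric]
    using b_nonneg by (intro mult_left_mono sum_\<theta>_diff_le) auto
  finally show ?case .
qed

text \<open>The sup norm of \<open>P\<^sup>k\<^sup>-\<^sup>j \<phi>\<^sub>j\<close> decays geometrically in \<open>k - j\<close>, its \<open>L\<^sup>1\<close> norm is at most \<open>2/j\<close>:
  in each product of two summands of \<open>h\<^sub>k\<close> the former is used for the smaller index.\<close>

lemma integral_h_square: "(\<integral>x. (h k x)\<^sup>2 \<partial>M) \<le> H2 / real k"
proof -
  let ?a = "\<lambda>j. (P ^^ (k - j)) (\<phi> j)"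
  have L: "?a j \<in> Linf M" if "1 \<le> j" for j
    using that by (rule transfer_\<phi>_Linf)
  have "AE x in M. (h k x)\<^sup>2 \<le> 2 * (\<Sum>j=1..<k. \<bar>?a j x\<bar> * (H * \<theta> ^ (k - j)))"
    using AE_transfer_\<phi>_sup[of k]
  proof eventually_elim
    case (elim x)
    have "(h k x)\<^sup>2 \<le> 2 * (\<Sum>j=1..<k. \<bar>?a j x\<bar> * (\<Sum>i=1..j. \<bar>?a i x\<bar>))"
      unfolding h_def by (rule square_sum_le)
    also have "\<dots> \<le> 2 * (\<Sum>j=1..<k. \<bar>?a j x\<bar> * (H * \<theta> ^ (k - j)))"
    proof (intro mult_left_mono sum_mono)
      fix j assume j: "j \<in> {1..<k}"
      have "(\<Sum>i=1..j. \<bar>?a i x\<bar>) \<le> (\<Sum>i=1..j. 2 * C\<^sup>2 * b * \<theta> ^ (k - i))"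
        using elim j by (intro sum_mono) auto
      \<comment> \<open>For \<open>i \<le> j < k\<close> the exponent splits as
        \<open>k - i = (j - i) + (k - j)\<close>, and the second part does not depend on
        \<open>i\<close>.\<close>
      also have "\<dots> = 2 * C\<^sup>2 * b * (\<Sum>i=1..j. \<theta> ^ (j - i)) * \<theta> ^ (k - j)"
        using j unfolding sum_distrib_left sum_distrib_right
        by (intro sum.cong) (auto simp flip: power_add)
      also have "\<dots> \<le> 2 * C\<^sup>2 * b * G * \<theta> ^ (k - j)"
        unfolding G_def using \<theta> b_nonneg
        by (intro mult_right_mono mult_left_mono sum_geometric_le) (auto simp: inj_on_def)
      finally show "(\<Sum>i=1..j. \<bar>?a i x\<bar>) \<le> H * \<theta> ^ (k - j)" by (simp add: H_def)
    qed auto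
    finally show ?case .
  qed
  then have "(\<integral>x. (h k x)\<^sup>2 \<partial>M) \<le> (\<integral>x. 2 * (\<Sum>j=1..<k. \<bar>?a j x\<bar> * (H * \<theta> ^ (k - j))) \<partial>M)"
    by (intro integral_mono_AE) (auto intro!: Linf_intros h_Linf L)
  also have "\<dots> = 2 * (\<Sum>j=1..<k. (\<integral>x. \<bar>?a j x\<bar> \<partial>M) * (H * \<theta> ^ (k - j)))"
    using L by (simp add: Linf_integrable Linf_abs)
  also have "\<dots> \<le> 2 * (\<Sum>j=1..<k. (2 / real j) * (H * \<theta> ^ (k - j)))"
  proof (intro mult_left_mono sum_mono mult_right_mono)
    fix j assume "j \<in> {1..<k}"
    then have j: "1 \<le> j" by simp
    show "(\<integral>x. \<bar>?a j x\<bar> \<partial>M) \<le> 2 / real j"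
      using transfer_pow_L1[OF \<phi>_Linf[OF j] L[OF j]] integral_abs_\<phi>[OF j] by linarith
  qed (use H_nonneg \<theta> in auto)
  also have "\<dots> = 4 * H * (\<Sum>j=1..<k. \<theta> ^ (k - j) / real j)"
    by (simp add: sum_distrib_left mult_ac)
  also have "\<dots> \<le> 4 * H * (G / real k)"
    unfolding G_def using \<theta> H_nonneg by (intro mult_left_mono sum_geometric_div_le) auto
  finally show ?thesis by (simp add: H2_def)
qed

end

section \<open>Elementary estimates for the cosine and the exponential\<close>

lemma abs_cos_diff_le: "\<bar>cos x - cos y\<bar> \<le> \<bar>x - y :: real\<bar>"
proof -
  have "\<bar>cos x - cos y\<bar> = 2 * \<bar>sin ((x + y) / 2)\<bar> * \<bar>sin ((y - x) / 2)\<bar>"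
    by (simp add: cos_diff_cos abs_mult)
  also have "\<dots> \<le> 2 * 1 * \<bar>(y - x) / 2\<bar>"
    by (intro mult_mono abs_sin_x_le_abs_x) auto
  finally show ?thesis by simp
qed

text \<open>The error is the real part of \<open>iexp y\<close> times the second-order Taylor
  remainder of \<open>iexp x\<close>, and \<open>iexp y\<close> has modulus 1. The bound is
  therefore uniform in \<open>y\<close>.\<close>

lemma cos_add_approx:
  fixes x y :: real
  shows "\<bar>cos (y + x) - (cos y - x * sin y - x\<^sup>2 / 2 * cos y)\<bar> \<le> \<bar>x\<bar> ^ 3 / 6"
proof -
  let ?z = "iexp x - (\<Sum>k\<le>2. (\<i> * x) ^ k / fact k)"
  have z: "?z = iexp x - (1 + \<i> * x - x\<^sup>2 / 2)"
    by (simp add: numeral_2_eq_2 power2_eq_square field_simps)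
  have "cos (y + x) - (cos y - x * sin y - x\<^sup>2 / 2 * cos y) = Re (iexp y * ?z)"
    unfolding z by (simp add: cos_add Re_exp Im_exp algebra_simps power2_eq_square)
  also have "\<bar>\<dots>\<bar> \<le> cmod (iexp y * ?z)" by (rule abs_Re_le_cmod)
  also have "\<dots> = cmod ?z" by (simp add: norm_mult)
  also have "\<dots> \<le> \<bar>x\<bar> ^ Suc 2 / fact (Suc 2)" by (rule iexp_approx1)
  finally show ?thesis by (simp add: fact_numeral eval_nat_numeral)
qed

text \<open>From below \<open>1 - w \<le> exp (- w)\<close>; from above
  \<open>exp (- w) \<le> 1 / (1 + w)\<close>, where the quotient is at most
  \<open>1 - w + w^2\<close>.\<close>

lemma exp_minus_approx:
  fixes w :: real
  assumes "0 \<le> w"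
  shows "\<bar>1 - w - exp (- w)\<bar> \<le> w\<^sup>2"
proof -
  have "exp (- w) \<le> 1 / (1 + w)"
    using exp_ge_add_one_self[of w] assms by (simp add: exp_minus field_simps)
  also have "\<dots> \<le> 1 - w + w\<^sup>2"
  proof -
    have "(1 - w + w\<^sup>2) * (1 + w) = 1 + w ^ 3"
      by (simp add: power2_eq_square power3_eq_cube algebra_simps)
    then show ?thesis using assms by (simp add: field_simps)
  qed
  finally show ?thesis using exp_ge_add_one_self[of "- w"] by (simp add: abs_le_iff)
qed

text \<open>Replacing the factor \<open>1 - w k\<close> by \<open>exp (- w k)\<close> costs
  \<open>(w k)^2\<close>. As the \<open>A k\<close> and the accumulated exponentials are at most 1
  in modulus, errors of earlier steps are never amplified and simply add up.\<close>

lemma product_telescope_le: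
  fixes A w e :: "nat \<Rightarrow> real"
  assumes "\<And>k. 1 \<le> k \<Longrightarrow> k \<le> n \<Longrightarrow> \<bar>A k - (1 - w k) * A (Suc k)\<bar> \<le> e k"
    and "\<And>k. \<bar>A k\<bar> \<le> 1" and "\<And>k. 0 \<le> w k"
  shows "\<bar>A 1 - exp (- (\<Sum>k=1..n. w k)) * A (Suc n)\<bar> \<le> (\<Sum>k=1..n. e k + (w k)\<^sup>2)"
  using assms(1)
proof (induction n)
  case (Suc n)
  let ?E = "exp (- (\<Sum>k=1..n. w k))"
  have E: "0 \<le> ?E" "?E \<le> 1" using assms(3) by (auto intro: sum_nonneg)
  let ?d = "A (Suc n) - exp (- w (Suc n)) * A (Suc (Suc n))"
  have "?d = (A (Suc n) - (1 - w (Suc n)) * A (Suc (Suc n))) + (1 - w (Suc n) - exp (- w (Suc n))) * A (Suc (Suc n))"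
    by (simp add: algebra_simps)
  moreover have "\<bar>(1 - w (Suc n) - exp (- w (Suc n))) * A (Suc (Suc n))\<bar> \<le> (w (Suc n))\<^sup>2 * 1"
    unfolding abs_mult using assms(2,3) by (intro mult_mono exp_minus_approx) auto
  ultimately have d: "\<bar>?d\<bar> \<le> e (Suc n) + (w (Suc n))\<^sup>2"
    using Suc.prems[of "Suc n"] by linarith
  have "A 1 - exp (- (\<Sum>k=1..Suc n. w k)) * A (Suc (Suc n)) = (A 1 - ?E * A (Suc n)) + ?E * ?d"
    by (simp add: exp_add exp_minus exp_diff field_simps)
  moreover have "\<bar>?E * ?d\<bar> \<le> 1 * (e (Suc n) + (w (Suc n))\<^sup>2)"
    unfolding abs_mult using E d by (intro mult_mono) auto
  ultimately show ?case using Suc by simp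
qed simp

section \<open>Reverse martingale differences and their tail sums\<close>

context shrinking_targets
begin

lemma u_eq_sum: "1 \<le> k \<Longrightarrow> u k x = (\<Sum>j=1..<Suc k. (P ^^ (k - j)) (\<phi> j) x)"
  by (simp add: u_def h_def)

lemma u_Linf: "1 \<le> k \<Longrightarrow> u k \<in> Linf M"
  unfolding u_def[abs_def] by (intro Linf_intros \<phi>_Linf h_Linf)

lemma \<psi>_Linf: "1 \<le> k \<Longrightarrow> \<psi> k \<in> Linf M"
  unfolding \<psi>_def[abs_def] by (intro Linf_intros u_Linf h_Linf)

lemma u_sup:
  assumes "1 \<le> k" shows "AE x in M. \<bar>u k x\<bar> \<le> 1 + H"
  using h_sup[of k]
proof eventually_elim
  case (elim x)
  then show ?case using \<phi>_abs_le[OF assms, of x] by (simp add: u_def)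
qed

lemma \<psi>_sup:
  assumes "1 \<le> k" shows "AE x in M. \<bar>\<psi> k x\<bar> \<le> 1 + 2 * H"
  using u_sup[OF assms] AE_T[OF h_sup[of "Suc k"]]
  by eventually_elim (simp add: \<psi>_def)

text \<open>Weak form of \<open>P (u k) = h (Suc k)\<close>: every summand of \<open>u k\<close>
  acquires one more power of \<open>P\<close>.\<close>

lemma u_dual:
  assumes k: "1 \<le> k" and g: "g \<in> Linf M"
  shows "(\<integral>x. u k x * g (T x) \<partial>M) = (\<integral>x. h (Suc k) x * g x \<partial>M)"
proof -
  have L: "(P ^^ n) (\<phi> j) \<in> Linf M" if "j \<in> {1..<Suc k}" for j n
    using that by (intro transfer_\<phi>_Linf) auto
  have "(\<integral>x. u k x * g (T x) \<partial>M) = (\<Sum>j=1..<Suc k. \<integral>x. (P ^^ (k - j)) (\<phi> j) x * g (T x) \<partial>M)"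
    unfolding u_eq_sum[OF k] sum_distrib_right
    by (rule Bochner_Integration.integral_sum) (intro Linf_intros L g)
  also have "\<dots> = (\<Sum>j=1..<Suc k. \<integral>x. (P ^^ (Suc k - j)) (\<phi> j) x * g x \<partial>M)"
  proof (rule sum.cong[OF refl])
    fix j assume j: "j \<in> {1..<Suc k}"
    then have "Suc k - j = Suc (k - j)" by auto
    then show "(\<integral>x. (P ^^ (k - j)) (\<phi> j) x * g (T x) \<partial>M) = (\<integral>x. (P ^^ (Suc k - j)) (\<phi> j) x * g x \<partial>M)"
      using transfer Linf_L2[OF L[OF j]] Linf_L2[OF g] by (simp add: transfer_operator_def)
  qed
  also have "\<dots> = (\<integral>x. h (Suc k) x * g x \<partial>M)"
    unfolding h_def sum_distrib_right
    by (rule Bochner_Integration.integral_sum[symmetric]) (intro Linf_intros L g)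
  finally show ?thesis .
qed

text \<open>Weak form of \<open>P (\<psi> k) = 0\<close>, the reverse martingale difference
  property.\<close>

lemma \<psi>_orthogonal:
  assumes k: "1 \<le> k" and g: "g \<in> Linf M"
  shows "(\<integral>x. \<psi> k x * g (T x) \<partial>M) = 0"
proof -
  have "(\<integral>x. \<psi> k x * g (T x) \<partial>M) = (\<integral>x. u k x * g (T x) \<partial>M) - (\<integral>x. h (Suc k) (T x) * g (T x) \<partial>M)"
    unfolding \<psi>_def left_diff_distrib
    by (rule Bochner_Integration.integral_diff) (intro Linf_intros u_Linf h_Linf g k)+
  also have "(\<integral>x. h (Suc k) (T x) * g (T x) \<partial>M) = (\<integral>x. h (Suc k) x * g x \<partial>M)"
    by (rule integral_T) (intro Linf_measurable Linf_intros h_Linf g)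
  finally show ?thesis by (simp add: u_dual[OF k g])
qed

text \<open>By \<open>u_dual\<close> the cross term equals minus twice the integral of the squared
  corrector times \<open>g\<close>, and the square of the composed corrector gives it back once. The
  composition with \<open>T\<close> inside \<open>\<psi> k\<close> is thereby removed, leaving
  squares of functions in \<open>BV M K\<close>, to which decay of correlations applies.\<close>

lemma integral_\<psi>_square_mult:
  assumes k: "1 \<le> k" and g: "g \<in> Linf M"
  shows "(\<integral>x. (\<psi> k x)\<^sup>2 * g (T x) \<partial>M) = (\<integral>x. (u k x)\<^sup>2 * g (T x) \<partial>M) - (\<integral>x. (h (Suc k) x)\<^sup>2 * g x \<partial>M)"
proof -
  let ?h = "h (Suc k)"
  have "(\<integral>x. (\<psi> k x)\<^sup>2 * g (T x) \<partial>M) =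
    (\<integral>x. (u k x)\<^sup>2 * g (T x) - 2 * (u k x * (?h (T x) * g (T x))) + (?h (T x))\<^sup>2 * g (T x) \<partial>M)"
    by (rule Bochner_Integration.integral_cong) (auto simp: \<psi>_def power2_eq_square algebra_simps)
  also have "\<dots> = (\<integral>x. (u k x)\<^sup>2 * g (T x) - 2 * (u k x * (?h (T x) * g (T x))) \<partial>M)
      + (\<integral>x. (?h (T x))\<^sup>2 * g (T x) \<partial>M)"
    by (rule Bochner_Integration.integral_add) (intro Linf_intros u_Linf h_Linf g k Linf_T)+
  also have "(\<integral>x. (u k x)\<^sup>2 * g (T x) - 2 * (u k x * (?h (T x) * g (T x))) \<partial>M) =
      (\<integral>x. (u k x)\<^sup>2 * g (T x) \<partial>M) - (\<integral>x. 2 * (u k x * (?h (T x) * g (T x))) \<partial>M)"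
    by (rule Bochner_Integration.integral_diff) (intro Linf_intros u_Linf h_Linf g k Linf_T)+
  also have "(\<integral>x. 2 * (u k x * (?h (T x) * g (T x))) \<partial>M) = 2 * (\<integral>x. ?h x * (?h x * g x) \<partial>M)"
    using u_dual[OF k, of "\<lambda>x. ?h x * g x"] by (simp add: Linf_intros h_Linf g)
  also have "(\<integral>x. (?h (T x))\<^sup>2 * g (T x) \<partial>M) = (\<integral>x. ?h x * (?h x * g x) \<partial>M)"
    using integral_T[of "\<lambda>x. (?h x)\<^sup>2 * g x"]
    by (simp add: Linf_measurable Linf_intros h_Linf g power2_eq_square mult.assoc)
  finally show ?thesis by (simp add: power2_eq_square mult.assoc)
qed

definition v :: "nat \<Rightarrow> real" where
  "v k = (\<integral>x. (\<psi> k x)\<^sup>2 \<partial>M)"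

lemma v_nonneg: "0 \<le> v k" by (simp add: v_def)

lemma v_eq: "1 \<le> k \<Longrightarrow> v k = (\<integral>x. (u k x)\<^sup>2 \<partial>M) - (\<integral>x. (h (Suc k) x)\<^sup>2 \<partial>M)"
  using integral_\<psi>_square_mult[of k "\<lambda>_. 1"] by (simp add: v_def Linf_const)

lemma v_le: assumes "1 \<le> k" shows "v k \<le> (1 + 2 * H)\<^sup>2"
proof -
  have "AE x in M. \<bar>(\<psi> k x)\<^sup>2\<bar> \<le> (1 + 2 * H)\<^sup>2"
    using \<psi>_sup[OF assms] by eventually_elim (use H_nonneg in \<open>auto simp: abs_le_square_iff[symmetric]\<close>)
  then show ?thesis
    using integral_le_AE_bound[of "\<lambda>x. (\<psi> k x)\<^sup>2"] Linf_measurable[OF Linf_power[OF \<psi>_Linf[OF assms]], of 2]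
    by (simp add: v_def)
qed

lemma integral_abs_\<psi>_cube_le:
  assumes "1 \<le> k" shows "(\<integral>x. \<bar>\<psi> k x\<bar> ^ 3 \<partial>M) \<le> (1 + 2 * H) * v k"
proof -
  have "AE x in M. \<bar>\<psi> k x\<bar> ^ 3 \<le> (1 + 2 * H) * (\<psi> k x)\<^sup>2"
    using \<psi>_sup[OF assms]
  proof eventually_elim
    case (elim x)
    then have "\<bar>\<psi> k x\<bar> * (\<psi> k x)\<^sup>2 \<le> (1 + 2 * H) * (\<psi> k x)\<^sup>2" by (rule mult_right_mono) simp
    then show ?case by (simp add: power3_eq_cube power2_eq_square mult.assoc flip: abs_mult)
  qed
  then have "(\<integral>x. \<bar>\<psi> k x\<bar> ^ 3 \<partial>M) \<le> (\<integral>x. (1 + 2 * H) * (\<psi> k x)\<^sup>2 \<partial>M)"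
    by (intro integral_mono_AE) (auto intro!: Linf_intros \<psi>_Linf[OF assms])
  then show ?thesis by (simp add: v_def)
qed

text \<open>The hits from time \<open>k\<close> to \<open>n\<close>, seen from time
  \<open>k\<close>, plus a boundary term chosen so that \<open>Z n k\<close> is exactly the sum of
  the later \<open>\<psi> j\<close> and a final corrector.\<close>

definition Z :: "nat \<Rightarrow> nat \<Rightarrow> 'a \<Rightarrow> real" where
  "Z n k x = (\<Sum>j=k..n. \<phi> j ((T ^^ (j - k)) x)) + h k x"

lemma Z_Linf: "1 \<le> k \<Longrightarrow> Z n k \<in> Linf M"
  unfolding Z_def[abs_def] by (intro Linf_intros Linf_T_pow \<phi>_Linf h_Linf) auto

lemma Z_Suc_n: "Z n (Suc n) = h (Suc n)"
  by (auto simp: Z_def)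

text \<open>The case \<open>l = Suc k\<close> is the peeling step \<open>Z_step\<close>; larger
  \<open>l\<close> opens a time gap for decoupling. The value \<open>l = Suc n\<close> is allowed,
  where only the corrector remains.\<close>

lemma Z_split:
  assumes "k \<le> l" "l \<le> Suc n"
  shows "Z n k x = (\<Sum>j=k..<l. \<phi> j ((T ^^ (j - k)) x)) + h k x - h l ((T ^^ (l - k)) x) + Z n l ((T ^^ (l - k)) x)"
proof -
  have "{k..n} = {k..<l} \<union> {l..n}" using assms by auto
  then have "(\<Sum>j=k..n. \<phi> j ((T ^^ (j - k)) x)) = (\<Sum>j=k..<l. \<phi> j ((T ^^ (j - k)) x)) + (\<Sum>j=l..n. \<phi> j ((T ^^ (j - k)) x))"
    by (simp only:) (rule sum.union_disjoint, auto)
  also have "(\<Sum>j=l..n. \<phi> j ((T ^^ (j - k)) x)) = (\<Sum>j=l..n. \<phi> j ((T ^^ (j - l)) ((T ^^ (l - k)) x)))"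
  proof (rule sum.cong[OF refl])
    fix j assume "j \<in> {l..n}"
    then have "j - k = (j - l) + (l - k)" using assms by auto
    then show "\<phi> j ((T ^^ (j - k)) x) = \<phi> j ((T ^^ (j - l)) ((T ^^ (l - k)) x))"
      by (simp add: funpow_add)
  qed
  finally show ?thesis by (simp add: Z_def)
qed

lemma Z_step: "k \<le> n \<Longrightarrow> Z n k x = \<psi> k x + Z n (Suc k) (T x)"
  using Z_split[of k "Suc k" n x] by (simp add: \<psi>_def u_def)

text \<open>Pythagoras: each \<open>\<psi> k\<close> is orthogonal to the rest, which is a function
  of \<open>T x\<close>.\<close>

lemma integral_Z_square:
  assumes "1 \<le> k" "k \<le> Suc n"
  shows "(\<integral>x. (Z n k x)\<^sup>2 \<partial>M) = (\<Sum>j=k..n. v j) + (\<integral>x. (h (Suc n) x)\<^sup>2 \<partial>M)"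
  using assms(2,1)
proof (induction k rule: inc_induct)
  case base
  show ?case by (simp add: Z_Suc_n)
next
  case (step k)
  have kn: "k \<le> n" using step by simp
  let ?Z = "Z n (Suc k)"
  have L: "?Z \<in> Linf M" "\<psi> k \<in> Linf M" using step by (auto intro: Z_Linf \<psi>_Linf)
  have "(\<integral>x. (Z n k x)\<^sup>2 \<partial>M) = (\<integral>x. ((\<psi> k x)\<^sup>2 + 2 * (\<psi> k x * ?Z (T x))) + (?Z (T x))\<^sup>2 \<partial>M)"
    by (rule Bochner_Integration.integral_cong) (auto simp: Z_step[OF kn] power2_eq_square algebra_simps)
  also have "\<dots> = (\<integral>x. (\<psi> k x)\<^sup>2 + 2 * (\<psi> k x * ?Z (T x)) \<partial>M) + (\<integral>x. (?Z (T x))\<^sup>2 \<partial>M)"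
    by (rule Bochner_Integration.integral_add) (intro Linf_intros Linf_T L)+
  also have "(\<integral>x. (\<psi> k x)\<^sup>2 + 2 * (\<psi> k x * ?Z (T x)) \<partial>M) = v k + (\<integral>x. 2 * (\<psi> k x * ?Z (T x)) \<partial>M)"
    unfolding v_def by (rule Bochner_Integration.integral_add) (intro Linf_intros Linf_T L)+
  also have "(\<integral>x. 2 * (\<psi> k x * ?Z (T x)) \<partial>M) = 0"
    using \<psi>_orthogonal[OF _ L(1), of k] step by simp
  also have "(\<integral>x. (?Z (T x))\<^sup>2 \<partial>M) = (\<integral>x. (?Z x)\<^sup>2 \<partial>M)"
    using integral_T[of "\<lambda>x. (?Z x)\<^sup>2"] by (simp add: Linf_measurable Linf_intros L)
  also have "\<dots> = (\<Sum>j=Suc k..n. v j) + (\<integral>x. (h (Suc n) x)\<^sup>2 \<partial>M)"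
    using step by simp
  finally show ?case using kn by (simp add: sum.atLeast_Suc_atMost)
qed

section \<open>The characteristic function\<close>

definition A :: real where
  "A = 4 + 4 * C\<^sup>2 * G + 4 * H + 4 * C\<^sup>2"

lemma A_nonneg: "0 \<le> A"
  using G_nonneg H_nonneg by (simp add: A_def)

definition cosZ :: "real \<Rightarrow> real \<Rightarrow> nat \<Rightarrow> nat \<Rightarrow> 'a \<Rightarrow> real" where
  "cosZ s a n k x = cos (s * Z n k x + a)"

lemma cosZ_Linf: "1 \<le> k \<Longrightarrow> cosZ s a n k \<in> Linf M"
  unfolding cosZ_def[abs_def]
  by (intro Linf_cos Linf_measurable[OF Linf_add[OF Linf_mult[OF Linf_const Z_Linf] Linf_const]])

lemma abs_cosZ_le: "\<bar>cosZ s a n k x\<bar> \<le> 1"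
  by (simp add: cosZ_def)

text \<open>The comparison length \<open>min k (n + 1 - k)\<close> keeps the number of correlations of \<open>q\<close> with the
  \<open>\<phi>\<^sub>j\<close> below \<open>k\<close>, so that they contribute \<open>O(1/k)\<close>, while \<open>\<theta>\<^sup>k\<close> is summable.\<close>

lemma correlation_cosZ:
  assumes k: "1 \<le> k" "k \<le> Suc n"
    and q: "q \<in> BV M K" "\<And>x. 0 \<le> q x" "bv_norm M K q \<le> Q" "(\<integral>x. q x \<partial>M) \<le> Q / real k"
  shows "\<bar>(\<integral>x. q x * cosZ s a n k ((T ^^ d) x) \<partial>M) - (\<integral>x. q x \<partial>M) * (\<integral>x. cosZ s a n k x \<partial>M)\<bar>
    \<le> Q * A * (\<bar>s\<bar> / real k + \<theta> ^ k + \<theta> ^ (Suc n - k))"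
proof -
  define r where "r = min k (Suc n - k)"
  define l where "l = k + r"
  have l: "k \<le> l" "l \<le> Suc n" "1 \<le> l" "l - k = r" "r \<le> k"
    using k by (auto simp: l_def r_def)
  have Q: "0 \<le> Q" using q(3) bv_norm_nonneg[of M K q] by linarith
  have qL: "q \<in> Linf M" using q(1) by (rule BV_Linf)
  have q0: "0 \<le> (\<integral>x. q x \<partial>M)" using q(2) by simp
  let ?g = "cosZ s a n k" and ?g' = "cosZ s a n l"
  have gL: "?g \<in> Linf M" "?g' \<in> Linf M" using k l by (auto intro: cosZ_Linf)
  \<comment> \<open>Compare with the observable that starts \<open>r\<close> steps later. The later
    one decorrelates from \<open>q\<close> at rate \<open>\<theta> ^ r\<close>; the difference
    \<open>D\<close> is dominated by \<open>\<bar>s\<bar> * E\<close>, where \<open>E\<close>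
    involves only the hits in the gap and two correctors.\<close>
  define D where "D x = ?g x - ?g' ((T ^^ r) x)" for x
  have DL: "D \<in> Linf M" unfolding D_def[abs_def] by (intro Linf_intros Linf_T_pow gL)
  define E where "E x = (\<Sum>j=k..<l. \<bar>\<phi> j ((T ^^ (j - k)) x)\<bar>) + 2 * H" for x
  have phiL: "\<phi> j \<in> Linf M" if "j \<in> {k..<l}" for j
    using that k by (intro \<phi>_Linf) auto
  have EL: "E \<in> Linf M" unfolding E_def[abs_def] by (intro Linf_intros Linf_T_pow phiL)
  have E0: "0 \<le> E x" for x using H_nonneg by (auto simp: E_def intro!: add_nonneg_nonneg sum_nonneg)
  have DE: "AE x in M. \<bar>D x\<bar> \<le> \<bar>s\<bar> * E x"
    using h_sup[of k] AE_T_pow[OF h_sup[of l], of r]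
  proof eventually_elim
    case (elim x)
    have "\<bar>D x\<bar> \<le> \<bar>(s * Z n k x + a) - (s * Z n l ((T ^^ r) x) + a)\<bar>"
      unfolding D_def cosZ_def by (rule abs_cos_diff_le)
    also have "\<dots> = \<bar>s\<bar> * \<bar>Z n k x - Z n l ((T ^^ r) x)\<bar>"
      by (simp flip: abs_mult right_diff_distrib)
    also have "\<bar>Z n k x - Z n l ((T ^^ r) x)\<bar> \<le> E x"
      using elim sum_abs[of "\<lambda>j. \<phi> j ((T ^^ (j - k)) x)" "{k..<l}"]
      unfolding Z_split[OF l(1,2)] E_def l(4) by linarith
    finally show ?case by (simp add: mult_left_mono)
  qed
  have far: "\<bar>(\<integral>x. q x * ?g' ((T ^^ (r + d)) x) \<partial>M) - (\<integral>x. q x \<partial>M) * (\<integral>x. ?g' x \<partial>M)\<bar>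
    \<le> 2 * C\<^sup>2 * Q * (\<theta> ^ k + \<theta> ^ (Suc n - k))"
  proof -
    have "\<theta> ^ (r + d) \<le> \<theta> ^ r" using \<theta> by (simp add: power_decreasing)
    \<comment> \<open>By the choice of \<open>r\<close>, the left side is one of the two
      summands.\<close>
    also have "\<dots> \<le> \<theta> ^ k + \<theta> ^ (Suc n - k)"
      using \<theta> by (auto simp: r_def min_def)
    finally have r: "\<theta> ^ (r + d) \<le> \<theta> ^ k + \<theta> ^ (Suc n - k)" .
    have "\<bar>(\<integral>x. q x * ?g' ((T ^^ (r + d)) x) \<partial>M) - (\<integral>x. q x \<partial>M) * (\<integral>x. ?g' x \<partial>M)\<bar>
        \<le> 2 * C\<^sup>2 * \<theta> ^ (r + d) * bv_norm M K q * (\<integral>x. \<bar>?g' x\<bar> \<partial>M)"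
      by (rule decay_of_correlations[OF q(1) gL(2)])
    also have "\<dots> \<le> 2 * C\<^sup>2 * (\<theta> ^ k + \<theta> ^ (Suc n - k)) * Q * 1"
      using r q(3) \<theta> Q integral_le_AE_bound[of ?g' 1] gL(2) abs_cosZ_le[of s a n l] bv_norm_nonneg[of M K q]
      by (intro mult_mono) (auto simp: Linf_measurable intro!: mult_nonneg_nonneg)
    finally show ?thesis by (simp add: mult_ac)
  qed
  \<comment> \<open>Correlated part: the mean of \<open>q\<close> and its variation norm each meet
    an \<open>L1\<close> norm of order \<open>1/k\<close>, so the hits in the gap contribute order
    \<open>1/k\<close> in total.\<close>
  have near1: "(\<integral>x. q x * E ((T ^^ d) x) \<partial>M) \<le> Q / real k * (2 + 4 * C\<^sup>2 * G + 2 * H)"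
  proof -
    have "(\<integral>x. q x * \<bar>\<phi> j ((T ^^ (j - k)) ((T ^^ d) x))\<bar> \<partial>M) \<le> 2 / real k * Q * (1 / real k + 2 * C\<^sup>2 * \<theta> ^ (j - k))"
      if j: "j \<in> {k..<l}" for j
    proof -
      have j1: "1 \<le> j" "k \<le> j" using j k by auto
      have "(\<integral>x. \<bar>\<phi> j x\<bar> \<partial>M) \<le> 2 / real j" using integral_abs_\<phi>[OF j1(1)] by simp
      also have "\<dots> \<le> 2 / real k" using j1 k by (intro divide_left_mono) auto
      finally have p: "(\<integral>x. \<bar>\<phi> j x\<bar> \<partial>M) \<le> 2 / real k" .
      have "(\<integral>x. q x * \<bar>\<phi> j ((T ^^ (j - k + d)) x)\<bar> \<partial>M) \<le> (\<integral>x. q x \<partial>M) * (\<integral>x. \<bar>\<phi> j x\<bar> \<partial>M)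
          + 2 * C\<^sup>2 * \<theta> ^ (j - k + d) * bv_norm M K q * (\<integral>x. \<bar>\<phi> j x\<bar> \<partial>M)"
        using decay_of_correlations[OF q(1) Linf_abs[OF phiL[OF j]], of "j - k + d"] by simp
      also have "\<dots> \<le> Q / real k * (2 / real k) + 2 * C\<^sup>2 * \<theta> ^ (j - k) * Q * (2 / real k)"
        using p q(3,4) q0 \<theta> Q k bv_norm_nonneg[of M K q]
        by (intro add_mono mult_mono) (auto simp: power_decreasing intro!: mult_nonneg_nonneg)
      also have "\<dots> = 2 / real k * Q * (1 / real k + 2 * C\<^sup>2 * \<theta> ^ (j - k))"
        by (simp add: algebra_simps)
      finally show ?thesis unfolding funpow_add o_apply .
    qed
    then have "(\<Sum>j=k..<l. \<integral>x. q x * \<bar>\<phi> j ((T ^^ (j - k)) ((T ^^ d) x))\<bar> \<partial>M)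
        \<le> (\<Sum>j=k..<l. 2 / real k * Q * (1 / real k + 2 * C\<^sup>2 * \<theta> ^ (j - k)))"
      by (rule sum_mono)
    also have "\<dots> = 2 / real k * Q * (real r / real k + 2 * C\<^sup>2 * (\<Sum>j=k..<l. \<theta> ^ (j - k)))"
      unfolding sum_distrib_left[symmetric] sum.distrib using l(4) by simp
    \<comment> \<open>Here \<open>r \<le> k\<close> is used: there are \<open>r\<close>
      product-of-means terms, so \<open>r / k\<close> is at most 1.\<close>
    also have "\<dots> \<le> 2 / real k * Q * (1 + 2 * C\<^sup>2 * G)"
      unfolding G_def using \<theta> Q k l(5)
      by (intro mult_left_mono add_mono sum_geometric_le) (auto simp: inj_on_def)
    finally have S: "(\<Sum>j=k..<l. \<integral>x. q x * \<bar>\<phi> j ((T ^^ (j - k)) ((T ^^ d) x))\<bar> \<partial>M) \<le> Q / real k * (2 + 4 * C\<^sup>2 * G)"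
      by (simp add: algebra_simps)
    have "(\<integral>x. q x * E ((T ^^ d) x) \<partial>M) = (\<integral>x. (\<Sum>j=k..<l. q x * \<bar>\<phi> j ((T ^^ (j - k)) ((T ^^ d) x))\<bar>) + q x * (2 * H) \<partial>M)"
      by (simp add: E_def distrib_left sum_distrib_left)
    also have "\<dots> = (\<integral>x. (\<Sum>j=k..<l. q x * \<bar>\<phi> j ((T ^^ (j - k)) ((T ^^ d) x))\<bar>) \<partial>M) + (\<integral>x. q x * (2 * H) \<partial>M)"
      by (rule Bochner_Integration.integral_add)
        (intro Linf_intros qL Linf_T_pow[where f = "\<lambda>x. \<bar>\<phi> j ((T ^^ (j - k)) x)\<bar>" for j] Linf_T_pow phiL; assumption)+
    also have "(\<integral>x. (\<Sum>j=k..<l. q x * \<bar>\<phi> j ((T ^^ (j - k)) ((T ^^ d) x))\<bar>) \<partial>M) = (\<Sum>j=k..<l. \<integral>x. q x * \<bar>\<phi> j ((T ^^ (j - k)) ((T ^^ d) x))\<bar> \<partial>M)"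
      by (rule Bochner_Integration.integral_sum)
        (intro Linf_intros qL Linf_T_pow[where f = "\<lambda>x. \<bar>\<phi> j ((T ^^ (j - k)) x)\<bar>" for j] Linf_T_pow phiL; assumption)
    also have "(\<integral>x. q x * (2 * H) \<partial>M) = (\<integral>x. q x \<partial>M) * (2 * H)" by simp
    also have "(\<integral>x. q x \<partial>M) * (2 * H) \<le> Q / real k * (2 * H)"
      using q(4) H_nonneg by (intro mult_right_mono) auto
    finally show ?thesis using S by (simp add: algebra_simps)
  qed
  \<comment> \<open>Without the weight \<open>q\<close> the gap contributes a bounded amount; the
    factor \<open>1/k\<close> then comes from the mean of \<open>q\<close>.\<close>
  have near2: "(\<integral>x. E x \<partial>M) \<le> 2 + 2 * H"
  proof -
    have "(\<lambda>x. \<bar>\<phi> j ((T ^^ (j - k)) x)\<bar>) \<in> Linf M" if "j \<in> {k..<l}" for j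
      using that by (intro Linf_abs Linf_T_pow phiL)
    then have int: "integrable M (\<lambda>x. \<bar>\<phi> j ((T ^^ (j - k)) x)\<bar>)" if "j \<in> {k..<l}" for j
      using that by (intro Linf_integrable)
    have "(\<integral>x. E x \<partial>M) = (\<integral>x. (\<Sum>j=k..<l. \<bar>\<phi> j ((T ^^ (j - k)) x)\<bar>) \<partial>M) + 2 * H"
      unfolding E_def by (subst Bochner_Integration.integral_add) (auto simp: prob_space intro: int)
    also have "(\<integral>x. (\<Sum>j=k..<l. \<bar>\<phi> j ((T ^^ (j - k)) x)\<bar>) \<partial>M) = (\<Sum>j=k..<l. \<integral>x. \<bar>\<phi> j ((T ^^ (j - k)) x)\<bar> \<partial>M)"
      by (rule Bochner_Integration.integral_sum) (rule int)
    also have "(\<Sum>j=k..<l. \<integral>x. \<bar>\<phi> j ((T ^^ (j - k)) x)\<bar> \<partial>M) \<le> (\<Sum>j=k..<l. 2 / real k)"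
    proof (rule sum_mono)
      fix j assume j: "j \<in> {k..<l}"
      then have j1: "1 \<le> j" "k \<le> j" using k by auto
      have "(\<integral>x. \<bar>\<phi> j ((T ^^ (j - k)) x)\<bar> \<partial>M) = (\<integral>x. \<bar>\<phi> j x\<bar> \<partial>M)"
        by (rule integral_T_pow[where f = "\<lambda>x. \<bar>\<phi> j x\<bar>"]) (intro Linf_measurable Linf_abs phiL j)
      also have "\<dots> \<le> 2 / real j" using integral_abs_\<phi>[OF j1(1)] by simp
      also have "\<dots> \<le> 2 / real k" using j1 k by (intro divide_left_mono) auto
      finally show "(\<integral>x. \<bar>\<phi> j ((T ^^ (j - k)) x)\<bar> \<partial>M) \<le> 2 / real k" .
    qed
    also have "(\<Sum>j=k..<l. 2 / real k) = 2 * (real r / real k)" using l(4) by simp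
    also have "\<dots> \<le> 2" using l(5) k by (simp add: divide_le_eq)
    finally show ?thesis by simp
  qed
  have "\<bar>\<integral>x. q x * D ((T ^^ d) x) \<partial>M\<bar> \<le> (\<integral>x. \<bar>q x * D ((T ^^ d) x)\<bar> \<partial>M)"
    by (rule integral_abs_bound)
  also have "\<dots> \<le> (\<integral>x. \<bar>s\<bar> * (q x * E ((T ^^ d) x)) \<partial>M)"
  proof (rule integral_mono_AE)
    show "AE x in M. \<bar>q x * D ((T ^^ d) x)\<bar> \<le> \<bar>s\<bar> * (q x * E ((T ^^ d) x))"
      using AE_T_pow[OF DE, of d]
    proof eventually_elim
      case (elim x)
      from mult_left_mono[OF elim q(2)[of x]] q(2)[of x] show ?case
        by (simp add: abs_mult mult.left_commute)
    qed
  qed (intro Linf_intros Linf_T_pow qL DL EL)+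
  also have "\<dots> \<le> \<bar>s\<bar> * (Q / real k * (2 + 4 * C\<^sup>2 * G + 2 * H))"
    using mult_left_mono[OF near1, of "\<bar>s\<bar>"] by simp
  finally have D1: "\<bar>\<integral>x. q x * D ((T ^^ d) x) \<partial>M\<bar> \<le> \<bar>s\<bar> * (Q / real k * (2 + 4 * C\<^sup>2 * G + 2 * H))" .
  have "\<bar>\<integral>x. D x \<partial>M\<bar> \<le> (\<integral>x. \<bar>D x\<bar> \<partial>M)" by (rule integral_abs_bound)
  also have "\<dots> \<le> (\<integral>x. \<bar>s\<bar> * E x \<partial>M)"
    using DE by (intro integral_mono_AE) (auto intro!: Linf_intros DL EL)
  also have "\<dots> \<le> \<bar>s\<bar> * (2 + 2 * H)" using near2 by (simp add: mult_left_mono)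
  finally have "\<bar>(\<integral>x. q x \<partial>M) * (\<integral>x. D x \<partial>M)\<bar> \<le> Q / real k * (\<bar>s\<bar> * (2 + 2 * H))"
    unfolding abs_mult using q(4) q0 Q by (intro mult_mono) auto
  moreover have "\<bar>s\<bar> * (Q / real k * (2 + 4 * C\<^sup>2 * G + 2 * H)) + Q / real k * (\<bar>s\<bar> * (2 + 2 * H))
      = Q * (\<bar>s\<bar> / real k) * (4 + 4 * C\<^sup>2 * G + 4 * H)"
    using k by (simp add: field_simps)
  ultimately have D2: "\<bar>(\<integral>x. q x * D ((T ^^ d) x) \<partial>M) - (\<integral>x. q x \<partial>M) * (\<integral>x. D x \<partial>M)\<bar>
      \<le> Q * (\<bar>s\<bar> / real k) * (4 + 4 * C\<^sup>2 * G + 4 * H)"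
    using D1 by linarith
  have e1: "(\<integral>x. q x * D ((T ^^ d) x) \<partial>M) = (\<integral>x. q x * ?g ((T ^^ d) x) \<partial>M) - (\<integral>x. q x * ?g' ((T ^^ (r + d)) x) \<partial>M)"
    unfolding D_def right_diff_distrib funpow_add o_apply
    by (rule Bochner_Integration.integral_diff)
      (intro Linf_integrable Linf_mult qL Linf_T_pow[where f = "\<lambda>x. ?g' ((T ^^ r) x)"] Linf_T_pow gL)+
  have e2: "(\<integral>x. D x \<partial>M) = (\<integral>x. ?g x \<partial>M) - (\<integral>x. ?g' x \<partial>M)"
  proof -
    have "(\<integral>x. D x \<partial>M) = (\<integral>x. ?g x \<partial>M) - (\<integral>x. ?g' ((T ^^ r) x) \<partial>M)"
      unfolding D_def by (rule Bochner_Integration.integral_diff) (intro Linf_intros Linf_T_pow gL)+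
    then show ?thesis by (simp add: integral_T_pow Linf_measurable gL)
  qed
  have "\<bar>(\<integral>x. q x * ?g ((T ^^ d) x) \<partial>M) - (\<integral>x. q x \<partial>M) * (\<integral>x. ?g x \<partial>M)\<bar>
    \<le> Q * (\<bar>s\<bar> / real k) * (4 + 4 * C\<^sup>2 * G + 4 * H) + 2 * C\<^sup>2 * Q * (\<theta> ^ k + \<theta> ^ (Suc n - k))"
    using far D2 unfolding e1 e2 right_diff_distrib by linarith
  also have "\<dots> \<le> Q * (\<bar>s\<bar> / real k) * A + Q * (\<theta> ^ k + \<theta> ^ (Suc n - k)) * A"
  proof (rule add_mono)
    show "Q * (\<bar>s\<bar> / real k) * (4 + 4 * C\<^sup>2 * G + 4 * H) \<le> Q * (\<bar>s\<bar> / real k) * A"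
      using Q by (intro mult_left_mono) (auto simp: A_def)
    have "Q * (\<theta> ^ k + \<theta> ^ (Suc n - k)) * (2 * C\<^sup>2) \<le> Q * (\<theta> ^ k + \<theta> ^ (Suc n - k)) * A"
      using Q \<theta> G_nonneg H_nonneg by (intro mult_left_mono) (auto simp: A_def intro!: add_nonneg_nonneg)
    then show "2 * C\<^sup>2 * Q * (\<theta> ^ k + \<theta> ^ (Suc n - k)) \<le> Q * (\<theta> ^ k + \<theta> ^ (Suc n - k)) * A"
      by (simp add: mult_ac)
  qed
  finally show ?thesis by (simp add: algebra_simps)
qed

text \<open>A common bound for the squares of \<open>u k\<close> and \<open>h k\<close>: the product
  dominates their variation norms via \<open>BV_square\<close>, and \<open>4 + 4 * H2\<close>
  handles the means.\<close>

definition Q :: real where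
  "Q = 2 * (1 + H) * (2 * b + H) + 4 + 4 * H2"

lemma Q_nonneg: "0 \<le> Q"
  using H_nonneg H2_nonneg b_nonneg by (simp add: Q_def)

lemma u_square_BV:
  assumes k: "1 \<le> k"
  shows "(\<lambda>x. (u k x)\<^sup>2) \<in> BV M K" "bv_norm M K (\<lambda>x. (u k x)\<^sup>2) \<le> Q"
    "(\<integral>x. (u k x)\<^sup>2 \<partial>M) \<le> Q / real (Suc k)"
proof -
  have u: "u k \<in> BV M K" "bv_norm M K (u k) \<le> 2 * b + H"
    using BV_add[OF \<phi>_BV(1)[OF k] h_BV(1)[of k]] \<phi>_BV(2)[OF k] h_BV(2)[of k]
    by (auto simp: u_def[abs_def])
  have H1: "0 \<le> 1 + H" using H_nonneg by simp
  note sq = BV_square[OF u(1) H1 u_sup[OF k]]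
  show "(\<lambda>x. (u k x)\<^sup>2) \<in> BV M K" by (rule sq)
  have "2 * (1 + H) * bv_norm M K (u k) \<le> 2 * (1 + H) * (2 * b + H)"
    using u(2) H1 by (intro mult_left_mono) auto
  then show "bv_norm M K (\<lambda>x. (u k x)\<^sup>2) \<le> Q"
    using sq(2) H2_nonneg by (simp add: Q_def)
  have L: "\<phi> k \<in> Linf M" using k by (rule \<phi>_Linf)
  have "(u k x)\<^sup>2 \<le> 2 * (\<phi> k x)\<^sup>2 + 2 * (h k x)\<^sup>2" for x
    using zero_le_power2[of "\<phi> k x - h k x"] by (simp add: u_def power2_eq_square algebra_simps)
  then have "(\<integral>x. (u k x)\<^sup>2 \<partial>M) \<le> (\<integral>x. 2 * (\<phi> k x)\<^sup>2 + 2 * (h k x)\<^sup>2 \<partial>M)"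
    by (intro integral_mono Linf_intros L h_Linf u_Linf k)
  also have "\<dots> = 2 * (\<integral>x. (\<phi> k x)\<^sup>2 \<partial>M) + 2 * (\<integral>x. (h k x)\<^sup>2 \<partial>M)"
    by (simp add: Linf_integrable Linf_power L h_Linf)
  also have "\<dots> \<le> 2 * (1 / real k) + 2 * (H2 / real k)"
    using integral_h_square[of k]
    by (intro add_mono mult_left_mono) (auto simp: integral_\<phi>_square[OF k])
  also have "\<dots> = (2 + 2 * H2) / real k"
    by (simp add: add_divide_distrib)
  also have "\<dots> \<le> Q / real (Suc k)"
  proof -
    \<comment> \<open>The mean is needed relative to \<open>Suc k\<close>, the index at which
      \<open>correlation_cosZ\<close> is applied; \<open>Suc k \<le> 2 * k\<close> accounts for a
      factor 2 in \<open>Q\<close>.\<close>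
    have "(2 + 2 * H2) * real (Suc k) \<le> (2 + 2 * H2) * (2 * real k)"
      using k H2_nonneg by (intro mult_left_mono) auto
    also have "\<dots> \<le> Q * real k"
      using H_nonneg b_nonneg unfolding mult.assoc[symmetric]
      by (intro mult_right_mono) (auto simp: Q_def)
    finally show ?thesis using k by (simp add: divide_simps)
  qed
  finally show "(\<integral>x. (u k x)\<^sup>2 \<partial>M) \<le> Q / real (Suc k)" .
qed

lemma h_square_BV:
  shows "(\<lambda>x. (h k x)\<^sup>2) \<in> BV M K" "bv_norm M K (\<lambda>x. (h k x)\<^sup>2) \<le> Q"
    "(\<integral>x. (h k x)\<^sup>2 \<partial>M) \<le> Q / real k"
proof -
  note sq = BV_square[OF h_BV(1)[of k] H_nonneg h_sup[of k]]
  show "(\<lambda>x. (h k x)\<^sup>2) \<in> BV M K" by (rule sq)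
  note sq(2)
  also have "2 * H * bv_norm M K (h k) \<le> 2 * (1 + H) * (2 * b + H)"
    using h_BV(2)[of k] H_nonneg b_nonneg bv_norm_nonneg[of M K "h k"] by (intro mult_mono) auto
  also have "\<dots> \<le> Q" using H2_nonneg by (simp add: Q_def)
  finally show "bv_norm M K (\<lambda>x. (h k x)\<^sup>2) \<le> Q" .
  have "H2 \<le> Q" using H2_nonneg H_nonneg b_nonneg by (simp add: Q_def)
  then have "H2 / real k \<le> Q / real k" by (simp add: divide_right_mono)
  then show "(\<integral>x. (h k x)\<^sup>2 \<partial>M) \<le> Q / real k"
    using integral_h_square[of k] by linarith
qed

text \<open>The error in \<open>correlation_cosZ\<close> at index \<open>Suc k\<close>, where
  \<open>Suc n - Suc k = n - k\<close>.\<close>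

definition \<epsilon> :: "real \<Rightarrow> nat \<Rightarrow> nat \<Rightarrow> real" where
  "\<epsilon> s n k = \<bar>s\<bar> / real (Suc k) + \<theta> ^ Suc k + \<theta> ^ (n - k)"

lemma correlation_\<psi>_square:
  assumes k: "1 \<le> k" "k \<le> n"
  shows "\<bar>(\<integral>x. (\<psi> k x)\<^sup>2 * cosZ s a n (Suc k) (T x) \<partial>M) - v k * (\<integral>x. cosZ s a n (Suc k) x \<partial>M)\<bar>
    \<le> 2 * Q * A * \<epsilon> s n k"
proof -
  let ?g = "cosZ s a n (Suc k)"
  \<comment> \<open>The delay is \<open>d = 1\<close> for the square of \<open>u k\<close>, which is
    paired with a function of \<open>T x\<close>, and \<open>d = 0\<close> below for the square of
    \<open>h (Suc k)\<close>.\<close>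
  have "\<bar>(\<integral>x. (u k x)\<^sup>2 * ?g ((T ^^ 1) x) \<partial>M) - (\<integral>x. (u k x)\<^sup>2 \<partial>M) * (\<integral>x. ?g x \<partial>M)\<bar>
      \<le> Q * A * (\<bar>s\<bar> / real (Suc k) + \<theta> ^ Suc k + \<theta> ^ (Suc n - Suc k))"
    using k by (intro correlation_cosZ u_square_BV) auto
  then have 1: "\<bar>(\<integral>x. (u k x)\<^sup>2 * ?g (T x) \<partial>M) - (\<integral>x. (u k x)\<^sup>2 \<partial>M) * (\<integral>x. ?g x \<partial>M)\<bar> \<le> Q * A * \<epsilon> s n k"
    by (simp add: \<epsilon>_def)
  have "\<bar>(\<integral>x. (h (Suc k) x)\<^sup>2 * ?g ((T ^^ 0) x) \<partial>M) - (\<integral>x. (h (Suc k) x)\<^sup>2 \<partial>M) * (\<integral>x. ?g x \<partial>M)\<bar>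
      \<le> Q * A * (\<bar>s\<bar> / real (Suc k) + \<theta> ^ Suc k + \<theta> ^ (Suc n - Suc k))"
    using k by (intro correlation_cosZ h_square_BV) auto
  then have 2: "\<bar>(\<integral>x. (h (Suc k) x)\<^sup>2 * ?g x \<partial>M) - (\<integral>x. (h (Suc k) x)\<^sup>2 \<partial>M) * (\<integral>x. ?g x \<partial>M)\<bar> \<le> Q * A * \<epsilon> s n k"
    by (simp add: \<epsilon>_def)
  have "?g \<in> Linf M" by (rule cosZ_Linf) simp
  then show ?thesis
    using 1 2 unfolding v_eq[OF k(1)] left_diff_distrib
    by (subst integral_\<psi>_square_mult[OF k(1)]) linarith+
qed

text \<open>Expand the cosine in \<open>s * \<psi> k x\<close> around the phase given by
  \<open>Z n (Suc k) (T x)\<close>. The linear term vanishes by \<open>\<psi>_orthogonal\<close>,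
  the quadratic term is \<open>v k\<close> times the next integral up to
  \<open>correlation_\<psi>_square\<close>, and the cubic remainder is controlled by the third
  moment.\<close>

lemma integral_cosZ_step:
  assumes k: "1 \<le> k" "k \<le> n"
  shows "\<bar>(\<integral>x. cosZ s a n k x \<partial>M) - (1 - s\<^sup>2 / 2 * v k) * (\<integral>x. cosZ s a n (Suc k) x \<partial>M)\<bar>
    \<le> \<bar>s\<bar> ^ 3 * (1 + 2 * H) * v k + s\<^sup>2 * Q * A * \<epsilon> s n k"
proof -
  let ?g = "cosZ s a n (Suc k)"
  let ?sg = "\<lambda>x. sin (s * Z n (Suc k) x + a)"
  have gL: "?g \<in> Linf M" by (rule cosZ_Linf) simp
  have sL: "?sg \<in> Linf M"
    by (intro Linf_sin Linf_measurable[OF Linf_add[OF Linf_mult[OF Linf_const Z_Linf] Linf_const]]) simp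
  have \<psi>L: "\<psi> k \<in> Linf M" using k by (intro \<psi>_Linf)
  note L = gL sL \<psi>L cosZ_Linf[OF k(1)] and LT = Linf_T[OF gL] Linf_T[OF sL]
  define R where "R x = cosZ s a n k x - ((?g (T x) - s * (\<psi> k x * ?sg (T x))) - s\<^sup>2 / 2 * ((\<psi> k x)\<^sup>2 * ?g (T x)))" for x
  have R_le: "\<bar>R x\<bar> \<le> \<bar>s\<bar> ^ 3 / 6 * \<bar>\<psi> k x\<bar> ^ 3" for x
  proof -
    let ?y = "s * Z n (Suc k) (T x) + a" and ?x = "s * \<psi> k x"
    have "s * Z n k x + a = ?y + ?x" by (simp add: Z_step[OF k(2)] distrib_left)
    then have eq: "R x = cos (?y + ?x) - (cos ?y - ?x * sin ?y - ?x\<^sup>2 / 2 * cos ?y)"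
      unfolding R_def cosZ_def by (simp only: power_mult_distrib mult.assoc times_divide_eq_left)
    have "\<bar>R x\<bar> \<le> \<bar>?x\<bar> ^ 3 / 6" unfolding eq by (rule cos_add_approx)
    then show ?thesis by (simp only: abs_mult power_mult_distrib times_divide_eq_left)
  qed
  have RL: "R \<in> Linf M"
    unfolding R_def[abs_def] by (intro Linf_diff Linf_mult Linf_power Linf_const LT L)
  have "\<bar>\<integral>x. R x \<partial>M\<bar> \<le> (\<integral>x. \<bar>R x\<bar> \<partial>M)" by (rule integral_abs_bound)
  also have "\<dots> \<le> (\<integral>x. \<bar>s\<bar> ^ 3 / 6 * \<bar>\<psi> k x\<bar> ^ 3 \<partial>M)"
    by (intro integral_mono R_le Linf_integrable Linf_abs Linf_mult Linf_const Linf_power RL L)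
  also have "\<dots> \<le> \<bar>s\<bar> ^ 3 / 6 * ((1 + 2 * H) * v k)"
    using mult_left_mono[OF integral_abs_\<psi>_cube_le[OF k(1)], of "\<bar>s\<bar> ^ 3 / 6"] by simp
  also have "\<dots> \<le> \<bar>s\<bar> ^ 3 * (1 + 2 * H) * v k"
    using H_nonneg v_nonneg[of k] by simp
  finally have 1: "\<bar>\<integral>x. R x \<partial>M\<bar> \<le> \<bar>s\<bar> ^ 3 * (1 + 2 * H) * v k" .
  have "(\<integral>x. R x \<partial>M) = (\<integral>x. cosZ s a n k x \<partial>M)
      - (((\<integral>x. ?g (T x) \<partial>M) - (\<integral>x. s * (\<psi> k x * ?sg (T x)) \<partial>M)) - (\<integral>x. s\<^sup>2 / 2 * ((\<psi> k x)\<^sup>2 * ?g (T x)) \<partial>M))"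
  proof -
    have i: "integrable M (cosZ s a n k)" "integrable M (\<lambda>x. ?g (T x))"
      "integrable M (\<lambda>x. s * (\<psi> k x * ?sg (T x)))" "integrable M (\<lambda>x. s\<^sup>2 / 2 * ((\<psi> k x)\<^sup>2 * ?g (T x)))"
      by (intro Linf_integrable Linf_mult Linf_power Linf_const LT L)+
    show ?thesis
      unfolding R_def by (simp only: Bochner_Integration.integral_diff i Bochner_Integration.integrable_diff)
  qed
  also have "(\<integral>x. s * (\<psi> k x * ?sg (T x)) \<partial>M) = 0"
    using \<psi>_orthogonal[OF k(1) sL] by simp
  also have "(\<integral>x. ?g (T x) \<partial>M) = (\<integral>x. ?g x \<partial>M)"
    by (rule integral_T[OF Linf_measurable[OF gL]])
  also have "(\<integral>x. s\<^sup>2 / 2 * ((\<psi> k x)\<^sup>2 * ?g (T x)) \<partial>M) = s\<^sup>2 / 2 * (\<integral>x. (\<psi> k x)\<^sup>2 * ?g (T x) \<partial>M)"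
    by simp
  finally have 2: "(\<integral>x. R x \<partial>M) = (\<integral>x. cosZ s a n k x \<partial>M) - (1 - s\<^sup>2 / 2 * v k) * (\<integral>x. ?g x \<partial>M)
      + s\<^sup>2 / 2 * ((\<integral>x. (\<psi> k x)\<^sup>2 * ?g (T x) \<partial>M) - v k * (\<integral>x. ?g x \<partial>M))"
    by (simp add: algebra_simps)
  have "\<bar>s\<^sup>2 / 2 * ((\<integral>x. (\<psi> k x)\<^sup>2 * ?g (T x) \<partial>M) - v k * (\<integral>x. ?g x \<partial>M))\<bar> \<le> s\<^sup>2 / 2 * (2 * Q * A * \<epsilon> s n k)"
    unfolding abs_mult using correlation_\<psi>_square[OF k, of s a] by (intro mult_mono) auto
  with 1 2 show ?thesis by simp
qed

definition V :: "nat \<Rightarrow> real" where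
  "V n = (\<Sum>k=1..n. v k)"

text \<open>All steps are multiplied together with \<open>w k = s^2 / 2 * v k\<close>. The bound is
  grouped around \<open>s^2 * V n\<close> and \<open>s^2 * harm n\<close>, which stay bounded for
  \<open>s = t / \<sigma> n\<close>; every term then carries a further factor tending to 0.\<close>

lemma integral_cosZ_approx:
  "\<bar>(\<integral>x. cosZ s a n 1 x \<partial>M) - exp (- (s\<^sup>2 / 2 * V n)) * (\<integral>x. cosZ s a n (Suc n) x \<partial>M)\<bar>
    \<le> \<bar>s\<bar> * (1 + 2 * H) * (s\<^sup>2 * V n) + Q * A * (\<bar>s\<bar> * (s\<^sup>2 * harm n) + 2 * G * s\<^sup>2)
      + s\<^sup>2 * (1 + 2 * H)\<^sup>2 * (s\<^sup>2 * V n)"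
proof -
  have b: "\<bar>\<integral>x. cosZ s a n k x \<partial>M\<bar> \<le> 1" for k
  proof -
    have "\<bar>\<integral>x. cosZ s a n k x \<partial>M\<bar> \<le> (\<integral>x. \<bar>cosZ s a n k x\<bar> \<partial>M)" by (rule integral_abs_bound)
    also have "\<dots> \<le> (\<integral>x. 1 \<partial>M)"
      by (rule integral_mono') (auto intro: abs_cosZ_le)
    finally show ?thesis by (simp add: prob_space)
  qed
  have "\<bar>(\<integral>x. cosZ s a n 1 x \<partial>M) - exp (- (\<Sum>k=1..n. s\<^sup>2 / 2 * v k)) * (\<integral>x. cosZ s a n (Suc n) x \<partial>M)\<bar>
    \<le> (\<Sum>k=1..n. (\<bar>s\<bar> ^ 3 * (1 + 2 * H) * v k + s\<^sup>2 * Q * A * \<epsilon> s n k) + (s\<^sup>2 / 2 * v k)\<^sup>2)"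
    by (rule product_telescope_le)
      (use integral_cosZ_step b v_nonneg in \<open>auto simp del: times_divide_eq_left One_nat_def intro: mult_nonneg_nonneg\<close>)
  also have "\<dots> \<le> (\<Sum>k=1..n. (\<bar>s\<bar> ^ 3 * (1 + 2 * H) * v k + s\<^sup>2 * Q * A * \<epsilon> s n k) + s ^ 4 * (1 + 2 * H)\<^sup>2 * v k)"
  proof (intro sum_mono add_left_mono)
    fix k assume k: "k \<in> {1..n}"
    have "(s\<^sup>2 / 2 * v k)\<^sup>2 = s ^ 4 / 4 * (v k * v k)"
      by (simp add: power2_eq_square power4_eq_xxxx)
    \<comment> \<open>One factor \<open>v k\<close> is bounded by \<open>v_le\<close>; the other is
      kept, so that summation gives \<open>V n\<close>.\<close>
    also have "\<dots> \<le> s ^ 4 * ((1 + 2 * H)\<^sup>2 * v k)"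
      using v_nonneg[of k] v_le[of k] k by (intro mult_mono) auto
    finally show "(s\<^sup>2 / 2 * v k)\<^sup>2 \<le> s ^ 4 * (1 + 2 * H)\<^sup>2 * v k" by (simp add: mult_ac)
  qed
  also have "\<dots> = \<bar>s\<bar> ^ 3 * (1 + 2 * H) * V n + s\<^sup>2 * Q * A * (\<Sum>k=1..n. \<epsilon> s n k) + s ^ 4 * (1 + 2 * H)\<^sup>2 * V n"
    by (simp add: sum.distrib sum_distrib_left V_def)
  also have "\<dots> \<le> \<bar>s\<bar> ^ 3 * (1 + 2 * H) * V n + s\<^sup>2 * Q * A * (\<bar>s\<bar> * harm n + 2 * G) + s ^ 4 * (1 + 2 * H)\<^sup>2 * V n"
  proof (intro add_right_mono add_left_mono mult_left_mono)
    have "(\<Sum>k=1..n. \<epsilon> s n k) = \<bar>s\<bar> * (\<Sum>k=1..n. 1 / real (Suc k)) + (\<Sum>k=1..n. \<theta> ^ Suc k) + (\<Sum>k=1..n. \<theta> ^ (n - k))"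
      by (simp add: \<epsilon>_def sum.distrib sum_distrib_left)
    also have "\<dots> \<le> \<bar>s\<bar> * harm n + G + G"
      unfolding harm_def G_def using \<theta>
      by (intro add_mono mult_left_mono sum_mono sum_geometric_le) (auto simp: inj_on_def field_simps)
    finally show "(\<Sum>k=1..n. \<epsilon> s n k) \<le> \<bar>s\<bar> * harm n + 2 * G" by simp
  qed (use Q_nonneg A_nonneg in auto)
  also have "\<dots> = \<bar>s\<bar> * (1 + 2 * H) * (s\<^sup>2 * V n) + Q * A * (\<bar>s\<bar> * (s\<^sup>2 * harm n) + 2 * G * s\<^sup>2)
      + s\<^sup>2 * (1 + 2 * H)\<^sup>2 * (s\<^sup>2 * V n)"
  proof -
    have "\<bar>s\<bar> ^ 3 = \<bar>s\<bar> * s\<^sup>2" by (simp add: power3_eq_cube power2_eq_square mult.assoc flip: abs_mult)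
    moreover have "s ^ 4 = s\<^sup>2 * s\<^sup>2" by (simp add: power2_eq_square power4_eq_xxxx)
    ultimately show ?thesis by (simp add: algebra_simps)
  qed
  finally show ?thesis by (simp add: V_def sum_distrib_left)
qed

section \<open>The central limit theorem\<close>

lemma h_1: "h (Suc 0) = (\<lambda>_. 0)"
  by (simp add: h_def[abs_def])

text \<open>The first hit is counted at time 1, hence the argument \<open>T x\<close>; no boundary
  term appears because \<open>h 1\<close> is an empty sum.\<close>

lemma centred_hits_eq_Z: "centred_hits T B n x = Z n 1 (T x)"
proof -
  have "\<phi> j ((T ^^ j) x) = \<phi> j ((T ^^ (j - 1)) (T x))" if "1 \<le> j" for j
    using that by (cases j) (auto simp: funpow_swap1)
  then show ?thesis
    by (auto simp: centred_hits_def Z_def h_1 \<phi>_def intro!: sum.cong)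
qed

lemma centred_hits_Linf: "centred_hits T B n \<in> Linf M"
  unfolding centred_hits_eq_Z[abs_def] by (intro Linf_T Z_Linf) simp

lemma hits_sd_square: "(hits_sd M T B n)\<^sup>2 = V n + (\<integral>x. (h (Suc n) x)\<^sup>2 \<partial>M)"
proof -
  have "(hits_sd M T B n)\<^sup>2 = (\<integral>x. (Z n 1 (T x))\<^sup>2 \<partial>M)"
    by (simp add: hits_sd_def centred_hits_eq_Z)
  also have "\<dots> = (\<integral>x. (Z n 1 x)\<^sup>2 \<partial>M)"
    by (rule integral_T) (intro Linf_measurable Linf_power Z_Linf, simp)
  also have "\<dots> = V n + (\<integral>x. (h (Suc n) x)\<^sup>2 \<partial>M)"
    using integral_Z_square[of 1 n] by (simp add: V_def)
  finally show ?thesis .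
qed

lemma abs_hits_sd_square_minus_V: "\<bar>(hits_sd M T B n)\<^sup>2 - V n\<bar> \<le> H2"
proof -
  have "(\<integral>x. (h (Suc n) x)\<^sup>2 \<partial>M) \<le> H2 / real (Suc n)" by (rule integral_h_square)
  also have "\<dots> \<le> H2 / 1" using H2_nonneg by (intro divide_left_mono) auto
  finally show ?thesis by (simp add: hits_sd_square)
qed

lemma integral_cos_centred_hits:
  "(\<integral>x. cos (s * centred_hits T B n x + a) \<partial>M) = (\<integral>x. cosZ s a n 1 x \<partial>M)"
  unfolding centred_hits_eq_Z cosZ_def[symmetric]
  by (rule integral_T) (intro Linf_measurable cosZ_Linf, simp)

lemma integral_cosZ_Suc_n: "\<bar>(\<integral>x. cosZ s a n (Suc n) x \<partial>M) - cos a\<bar> \<le> \<bar>s\<bar> * H"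
proof -
  let ?d = "\<lambda>x. cosZ s a n (Suc n) x - cos a"
  have L: "cosZ s a n (Suc n) \<in> Linf M" by (rule cosZ_Linf) simp
  have "AE x in M. \<bar>?d x\<bar> \<le> \<bar>s\<bar> * H"
    using h_sup[of "Suc n"]
  proof eventually_elim
    case (elim x)
    have "\<bar>?d x\<bar> \<le> \<bar>s * h (Suc n) x + a - a\<bar>"
      unfolding cosZ_def Z_Suc_n by (rule abs_cos_diff_le)
    also have "\<dots> \<le> \<bar>s\<bar> * H" using elim by (simp add: abs_mult mult_left_mono)
    finally show ?case .
  qed
  then have "(\<integral>x. \<bar>?d x\<bar> \<partial>M) \<le> \<bar>s\<bar> * H"
    by (intro integral_le_AE_bound Linf_measurable Linf_diff Linf_const L)
  then have "\<bar>\<integral>x. ?d x \<partial>M\<bar> \<le> \<bar>s\<bar> * H"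
    using integral_abs_bound[of M ?d] by linarith
  then show ?thesis by (simp add: Linf_integrable[OF L] prob_space)
qed

text \<open>These hypotheses cover both normalisations, the standard deviation and
  \<open>sqrt (ln n)\<close>. The one on \<open>harm n\<close> controls the correlation errors,
  which sum to the order of the harmonic numbers.\<close>

context
  fixes \<sigma> :: "nat \<Rightarrow> real"
  assumes \<sigma>: "filterlim \<sigma> at_top sequentially"
    and sd: "(\<lambda>n. (hits_sd M T B n)\<^sup>2 / (\<sigma> n)\<^sup>2) \<longlonglongrightarrow> 1"
    and harm: "(\<lambda>n. harm n / (\<sigma> n)\<^sup>2) \<in> O(\<lambda>_. 1)"
begin

lemma integral_cos_tendsto:
  "(\<lambda>n. \<integral>x. cos (t / \<sigma> n * centred_hits T B n x + a) \<partial>M) \<longlonglongrightarrow> exp (- t\<^sup>2 / 2) * cos a"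
proof -
  let ?s = "\<lambda>n. t / \<sigma> n"
  have s: "?s \<longlonglongrightarrow> 0"
    using tendsto_mult[OF tendsto_const[of t] tendsto_inverse_0_at_top[OF \<sigma>]] by (simp add: divide_inverse)
  have inv: "(\<lambda>n. 1 / (\<sigma> n)\<^sup>2) \<longlonglongrightarrow> 0"
    using tendsto_power[OF tendsto_inverse_0_at_top[OF \<sigma>], of 2] by (simp add: divide_inverse power_inverse)
  \<comment> \<open>\<open>V n\<close> and the squared standard deviation differ by at most
    \<open>H2\<close>, so they have the same limit after division.\<close>
  have "(\<lambda>n. ((hits_sd M T B n)\<^sup>2 - V n) / (\<sigma> n)\<^sup>2) \<longlonglongrightarrow> 0"
  proof (rule Lim_null_comparison)
    show "\<forall>\<^sub>F n in sequentially. norm (((hits_sd M T B n)\<^sup>2 - V n) / (\<sigma> n)\<^sup>2) \<le> H2 * (1 / (\<sigma> n)\<^sup>2)"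
      using abs_hits_sd_square_minus_V by (auto simp: abs_divide divide_right_mono)
    show "(\<lambda>n. H2 * (1 / (\<sigma> n)\<^sup>2)) \<longlonglongrightarrow> 0" using tendsto_mult_right_zero[OF inv] by simp
  qed
  from tendsto_diff[OF sd this] have "(\<lambda>n. V n / (\<sigma> n)\<^sup>2) \<longlonglongrightarrow> 1"
    by (simp add: diff_divide_distrib)
  from tendsto_mult[OF tendsto_const[of "t\<^sup>2"] this] have sV: "(\<lambda>n. (?s n)\<^sup>2 * V n) \<longlonglongrightarrow> t\<^sup>2"
    by (simp add: power_divide)
  obtain c where c: "\<forall>\<^sub>F n in sequentially. norm (harm n / (\<sigma> n)\<^sup>2) \<le> c * norm (1::real)"
    using harm by (rule landau_o.bigE)
  have sh: "(\<lambda>n. \<bar>?s n\<bar> * ((?s n)\<^sup>2 * harm n)) \<longlonglongrightarrow> 0"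
  proof (rule Lim_null_comparison)
    show "\<forall>\<^sub>F n in sequentially. norm (\<bar>?s n\<bar> * ((?s n)\<^sup>2 * harm n)) \<le> \<bar>?s n\<bar> * (t\<^sup>2 * c)"
      using c
    proof eventually_elim
      case (elim n)
      have "norm (\<bar>?s n\<bar> * ((?s n)\<^sup>2 * harm n)) = \<bar>?s n\<bar> * (t\<^sup>2 * norm (harm n / (\<sigma> n)\<^sup>2))"
        by (simp add: abs_mult power_divide)
      also have "\<dots> \<le> \<bar>?s n\<bar> * (t\<^sup>2 * c)"
        using elim by (intro mult_left_mono) auto
      finally show ?case .
    qed
    show "(\<lambda>n. \<bar>?s n\<bar> * (t\<^sup>2 * c)) \<longlonglongrightarrow> 0"
      using tendsto_mult_left_zero[OF tendsto_rabs_zero[OF s]] by simp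
  qed
  have err: "(\<lambda>n. \<bar>?s n\<bar> * (1 + 2 * H) * ((?s n)\<^sup>2 * V n)
      + Q * A * (\<bar>?s n\<bar> * ((?s n)\<^sup>2 * harm n) + 2 * G * (?s n)\<^sup>2)
      + (?s n)\<^sup>2 * (1 + 2 * H)\<^sup>2 * ((?s n)\<^sup>2 * V n)) \<longlonglongrightarrow>
      \<bar>0\<bar> * (1 + 2 * H) * t\<^sup>2 + Q * A * (0 + 2 * G * 0\<^sup>2) + 0\<^sup>2 * (1 + 2 * H)\<^sup>2 * t\<^sup>2"
    by (intro tendsto_intros s sV sh)
  \<comment> \<open>What remains after all \<open>\<psi> k\<close> are peeled off is the bounded
    corrector \<open>h (Suc n)\<close>, which disappears as \<open>s\<close> tends to 0.\<close>
  have fin: "(\<lambda>n. exp (- ((?s n)\<^sup>2 / 2 * V n)) * (\<integral>x. cosZ (?s n) a n (Suc n) x \<partial>M)) \<longlonglongrightarrow> exp (- (t\<^sup>2 / 2)) * cos a"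
  proof (rule tendsto_mult)
    show "(\<lambda>n. exp (- ((?s n)\<^sup>2 / 2 * V n))) \<longlonglongrightarrow> exp (- (t\<^sup>2 / 2))"
      using tendsto_exp[OF tendsto_minus[OF tendsto_divide[OF sV tendsto_const[of 2]]]] by simp
    have "(\<lambda>n. (\<integral>x. cosZ (?s n) a n (Suc n) x \<partial>M) - cos a) \<longlonglongrightarrow> 0"
    proof (rule Lim_null_comparison)
      show "\<forall>\<^sub>F n in sequentially. norm ((\<integral>x. cosZ (?s n) a n (Suc n) x \<partial>M) - cos a) \<le> \<bar>?s n\<bar> * H"
        by (intro always_eventually allI) (simp only: real_norm_def integral_cosZ_Suc_n)
      show "(\<lambda>n. \<bar>?s n\<bar> * H) \<longlonglongrightarrow> 0"
        using tendsto_mult_left_zero[OF tendsto_rabs_zero[OF s]] by simp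
    qed
    then show "(\<lambda>n. \<integral>x. cosZ (?s n) a n (Suc n) x \<partial>M) \<longlonglongrightarrow> cos a"
      by (rule LIM_zero_cancel)
  qed
  have "(\<lambda>n. (\<integral>x. cosZ (?s n) a n 1 x \<partial>M) - exp (- ((?s n)\<^sup>2 / 2 * V n)) * (\<integral>x. cosZ (?s n) a n (Suc n) x \<partial>M)) \<longlonglongrightarrow> 0"
  proof (rule Lim_null_comparison)
    show "(\<lambda>n. \<bar>?s n\<bar> * (1 + 2 * H) * ((?s n)\<^sup>2 * V n)
      + Q * A * (\<bar>?s n\<bar> * ((?s n)\<^sup>2 * harm n) + 2 * G * (?s n)\<^sup>2)
      + (?s n)\<^sup>2 * (1 + 2 * H)\<^sup>2 * ((?s n)\<^sup>2 * V n)) \<longlonglongrightarrow> 0"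
      using err by simp
  qed (intro always_eventually allI, simp only: real_norm_def integral_cosZ_approx)
  from tendsto_add[OF this fin] show ?thesis
    unfolding integral_cos_centred_hits by simp
qed

lemma centred_hits_clt:
  "weak_conv_m (\<lambda>n. distr M borel (\<lambda>x. centred_hits T B n x / \<sigma> n)) std_normal_distribution"
proof (rule levy_continuity)
  have m [measurable]: "(\<lambda>x. centred_hits T B n x / \<sigma> n) \<in> borel_measurable M" for n
    using Linf_measurable[OF centred_hits_Linf, of n] by measurable
  show "real_distribution (distr M borel (\<lambda>x. centred_hits T B n x / \<sigma> n))" for n
    using m by (rule real_distribution_distr)
  show "real_distribution std_normal_distribution" by (rule real_dist_normal_dist)
  fix t :: real
  \<comment> \<open>The phases \<open>0\<close> and \<open>- (pi / 2)\<close> turn the cosine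
    integral into the real and the imaginary part.\<close>
  have "char (distr M borel (\<lambda>x. centred_hits T B n x / \<sigma> n)) t =
      complex_of_real (\<integral>x. cos (t / \<sigma> n * centred_hits T B n x + 0) \<partial>M)
      + \<i> * complex_of_real (\<integral>x. cos (t / \<sigma> n * centred_hits T B n x + - (pi / 2)) \<partial>M)" for n
  proof -
    define X where "X x = t / \<sigma> n * centred_hits T B n x" for x
    have X [measurable]: "X \<in> borel_measurable M"
      unfolding X_def[abs_def] using Linf_measurable[OF centred_hits_Linf, of n] by measurable
    have i: "integrable M (\<lambda>x. complex_of_real (cos (X x)))" "integrable M (\<lambda>x. \<i> * complex_of_real (sin (X x)))"
      by (intro integrable_mult_right integrable_of_real Linf_integrable Linf_cos Linf_sin X)+
    have "char (distr M borel (\<lambda>x. centred_hits T B n x / \<sigma> n)) t = (CLINT x|M. iexp (X x))"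
      unfolding char_def by (subst integral_distr) (auto simp: X_def)
    also have "\<dots> = (CLINT x|M. complex_of_real (cos (X x)) + \<i> * complex_of_real (sin (X x)))"
      by (intro Bochner_Integration.integral_cong) (auto simp: complex_eq_iff Re_exp Im_exp)
    also have "\<dots> = complex_of_real (\<integral>x. cos (X x) \<partial>M) + \<i> * complex_of_real (\<integral>x. sin (X x) \<partial>M)"
      using i by simp
    finally show ?thesis by (simp add: cos_diff X_def)
  qed
  moreover have "(\<lambda>n. complex_of_real (\<integral>x. cos (t / \<sigma> n * centred_hits T B n x + 0) \<partial>M)
      + \<i> * complex_of_real (\<integral>x. cos (t / \<sigma> n * centred_hits T B n x + - (pi / 2)) \<partial>M)) \<longlonglongrightarrow>
      complex_of_real (exp (- t\<^sup>2 / 2) * cos 0) + \<i> * complex_of_real (exp (- t\<^sup>2 / 2) * cos (- (pi / 2)))"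
    by (intro tendsto_intros integral_cos_tendsto)
  ultimately show "(\<lambda>n. char (distr M borel (\<lambda>x. centred_hits T B n x / \<sigma> n)) t) \<longlonglongrightarrow> char std_normal_distribution t"
    by (simp add: char_std_normal_distribution)
qed

end

end

section \<open>The growth of the variance\<close>

lemma summable_sum_bound:
  fixes f :: "nat \<Rightarrow> real"
  assumes "summable f" "\<And>k. 0 \<le> f k"
  shows "(\<Sum>k=1..n. f k) \<le> suminf f"
  using assms by (intro sum_le_suminf) auto

text \<open>The difference converges, to the Euler-Mascheroni constant.\<close>

lemma abs_harm_minus_ln_bounded: "\<exists>D. \<forall>n. \<bar>harm n - ln (real n)\<bar> \<le> D"
proof -
  have "Bseq (\<lambda>n. harm n - ln (real n))"
    using euler_mascheroni_convergent by (rule convergent_imp_Bseq)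
  then show ?thesis by (auto simp: Bseq_def)
qed

context shrinking_targets
begin

text \<open>For \<open>i < k\<close>, by invariance, the covariance of the hits at times
  \<open>i\<close> and \<open>k\<close>.\<close>

definition c :: "nat \<Rightarrow> nat \<Rightarrow> real" where
  "c i k = (\<integral>x. \<phi> i x * \<phi> k ((T ^^ (k - i)) x) \<partial>M)"

definition F :: real where
  "F = 8 * C\<^sup>2 * b"

lemma F_nonneg: "0 \<le> F" using b_nonneg by (simp add: F_def)

lemma c_eq:
  assumes "1 \<le> i" "1 \<le> k"
  shows "c i k = measure M (B i \<inter> (T ^^ (k - i)) -` B k) - 1 / (real i * real k)"
proof -
  have [measurable]: "B i \<in> sets M" "B k \<in> sets M" using assms by (auto intro: B_sets)
  let ?A = "B i \<inter> (T ^^ (k - i)) -` B k"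
  have "?A = B i \<inter> ((T ^^ (k - i)) -` B k \<inter> space M)"
    using sets.sets_into_space[OF B_sets[OF assms(1)]] by auto
  then have A: "?A \<in> sets M" by (simp add: measurable_sets[OF T_pow_measurable])
  let ?e = "\<lambda>x. indicator (B k) ((T ^^ (k - i)) x) :: real"
  have L: "indicator (B k) \<in> Linf M" "indicator (B i) \<in> Linf M" "indicator ?A \<in> Linf M"
    using A by (auto intro!: Linf_indicator)
  have eL: "?e \<in> Linf M" by (rule Linf_T_pow[OF L(1)])
  have "\<phi> i x * \<phi> k ((T ^^ (k - i)) x) = indicator ?A x - (1 / real k * indicator (B i) x + 1 / real i * ?e x)
      + 1 / (real i * real k)" for x
    by (auto simp: \<phi>_def indicator_def algebra_simps)
  then have "c i k = (\<integral>x. indicator ?A x - (1 / real k * indicator (B i) x + 1 / real i * ?e x)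
      + 1 / (real i * real k) \<partial>M)"
    by (simp add: c_def)
  also have "\<dots> = (\<integral>x. indicator ?A x - (1 / real k * indicator (B i) x + 1 / real i * ?e x) \<partial>M)
      + 1 / (real i * real k)"
    by (subst Bochner_Integration.integral_add)
      (simp_all del: times_divide_eq_left add: prob_space Linf_integrable Linf_diff Linf_add Linf_mult Linf_const L eL)
  also have "(\<integral>x. indicator ?A x - (1 / real k * indicator (B i) x + 1 / real i * ?e x) \<partial>M)
      = (\<integral>x. indicator ?A x \<partial>M) - (\<integral>x. 1 / real k * indicator (B i) x + 1 / real i * ?e x \<partial>M)"
    by (rule Bochner_Integration.integral_diff)
      (intro Linf_integrable Linf_add Linf_mult Linf_const L eL)+
  also have "(\<integral>x. 1 / real k * indicator (B i) x + 1 / real i * ?e x \<partial>M)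
      = (\<integral>x. 1 / real k * indicator (B i) x \<partial>M) + (\<integral>x. 1 / real i * ?e x \<partial>M)"
    by (rule Bochner_Integration.integral_add) (intro Linf_integrable Linf_mult Linf_const L eL)+
  also have "(\<integral>x. 1 / real i * ?e x \<partial>M) = 1 / real i * (\<integral>x. ?e x \<partial>M)" by (rule integral_mult_right_zero)
  also have "(\<integral>x. ?e x \<partial>M) = (\<integral>x. indicator (B k) x \<partial>M)"
    by (rule integral_T_pow) (rule Linf_measurable[OF L(1)])
  finally show ?thesis
    using A assms sets.sets_into_space[OF A] by (simp add: B_measure B_Int_space Int_absorb2)
qed

text \<open>Decay of correlations with \<open>\<phi> i\<close> in the variation norm; the
  \<open>L1\<close> norm of \<open>\<phi> k\<close> provides \<open>1/k\<close>.\<close>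

lemma abs_c_le:
  assumes "1 \<le> i" "1 \<le> k"
  shows "\<bar>c i k\<bar> \<le> F * \<theta> ^ (k - i) / real k"
proof -
  have "\<bar>c i k\<bar> \<le> 2 * C\<^sup>2 * \<theta> ^ (k - i) * bv_norm M K (\<phi> i) * (\<integral>x. \<bar>\<phi> k x\<bar> \<partial>M)"
    using decay_of_correlations[OF \<phi>_BV(1)[OF assms(1)] \<phi>_Linf[OF assms(2)], of "k - i"]
    unfolding c_def integral_\<phi>[OF assms(1)] by simp
  also have "\<dots> \<le> 2 * C\<^sup>2 * \<theta> ^ (k - i) * (2 * b) * (2 / real k)"
    using \<theta> b_nonneg \<phi>_BV(2)[OF assms(1)] integral_abs_\<phi>[OF assms(2)] bv_norm_nonneg[of M K "\<phi> i"]
    by (intro mult_mono) auto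
  finally show ?thesis by (simp add: F_def mult_ac)
qed

lemma hits_sd_square_eq:
  "(hits_sd M T B n)\<^sup>2 = harm n - (\<Sum>k=1..n. 1 / (real k)\<^sup>2) + 2 * (\<Sum>k=1..n. \<Sum>i=1..<k. c i k)"
proof -
  define f where "f j x = \<phi> j ((T ^^ j) x)" for j x
  have S: "centred_hits T B n x = (\<Sum>j=1..n. f j x)" for n x
    by (simp add: centred_hits_def f_def \<phi>_def)
  have fL: "f j \<in> Linf M" if "1 \<le> j" for j
    unfolding f_def[abs_def] using that by (intro Linf_T_pow \<phi>_Linf)
  have ff: "(\<integral>x. (f k x)\<^sup>2 \<partial>M) = 1 / real k - 1 / (real k)\<^sup>2" if "1 \<le> k" for k
    unfolding f_def integral_\<phi>_square[OF that, symmetric]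
    by (rule integral_T_pow) (intro Linf_measurable Linf_power \<phi>_Linf that)
  have fc: "(\<integral>x. f i x * f k x \<partial>M) = c i k" if "1 \<le> i" "i < k" for i k
  proof -
    have "f k x = \<phi> k ((T ^^ (k - i)) ((T ^^ i) x))" for x
      using that funpow_add[of "k - i" i T] by (simp add: f_def)
    then have "(\<integral>x. f i x * f k x \<partial>M) = (\<integral>x. (\<lambda>x. \<phi> i x * \<phi> k ((T ^^ (k - i)) x)) ((T ^^ i) x) \<partial>M)"
      by (simp add: f_def)
    also have "\<dots> = c i k"
      unfolding c_def using that
      by (intro integral_T_pow Linf_measurable Linf_mult \<phi>_Linf Linf_T_pow) auto
    finally show ?thesis .
  qed
  have "(\<integral>x. (\<Sum>j=1..n. f j x)\<^sup>2 \<partial>M) = (\<Sum>k=1..n. (1 / real k - 1 / (real k)\<^sup>2) + 2 * (\<Sum>i=1..<k. c i k))"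
  proof (induction n)
    case (Suc n)
    let ?s = "\<lambda>x. \<Sum>j=1..n. f j x" and ?f = "f (Suc n)"
    have L: "?s \<in> Linf M" "?f \<in> Linf M" by (intro Linf_sum fL; simp)+
    have "(\<integral>x. (\<Sum>j=1..Suc n. f j x)\<^sup>2 \<partial>M) = (\<integral>x. ((?s x)\<^sup>2 + (?f x)\<^sup>2) + 2 * (\<Sum>i=1..n. f i x * ?f x) \<partial>M)"
      by (rule Bochner_Integration.integral_cong)
        (auto simp: power2_sum sum_distrib_right[symmetric])
    also have "\<dots> = (\<integral>x. (?s x)\<^sup>2 + (?f x)\<^sup>2 \<partial>M) + (\<integral>x. 2 * (\<Sum>i=1..n. f i x * ?f x) \<partial>M)"
      by (rule Bochner_Integration.integral_add)
        (intro Linf_integrable Linf_add Linf_power Linf_mult Linf_const Linf_sum L fL; simp)+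
    also have "(\<integral>x. (?s x)\<^sup>2 + (?f x)\<^sup>2 \<partial>M) = (\<integral>x. (?s x)\<^sup>2 \<partial>M) + (\<integral>x. (?f x)\<^sup>2 \<partial>M)"
      by (rule Bochner_Integration.integral_add) (intro Linf_integrable Linf_power L)+
    also have "(\<integral>x. 2 * (\<Sum>i=1..n. f i x * ?f x) \<partial>M) = 2 * (\<integral>x. (\<Sum>i=1..n. f i x * ?f x) \<partial>M)"
      by (rule integral_mult_right_zero)
    also have "(\<integral>x. (\<Sum>i=1..n. f i x * ?f x) \<partial>M) = (\<Sum>i=1..n. \<integral>x. f i x * ?f x \<partial>M)"
      by (rule Bochner_Integration.integral_sum) (intro Linf_integrable Linf_mult L fL; simp)
    also have "\<dots> = (\<Sum>i=1..<Suc n. c i (Suc n))"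
      by (rule sum.cong) (auto simp: fc)
    finally show ?case
      using Suc ff[of "Suc n"] by simp
  qed simp
  moreover have "(hits_sd M T B n)\<^sup>2 = (\<integral>x. (centred_hits T B n x)\<^sup>2 \<partial>M)"
    by (simp add: hits_sd_def)
  ultimately have "(hits_sd M T B n)\<^sup>2 = (\<Sum>k=1..n. (1 / real k - 1 / (real k)\<^sup>2) + 2 * (\<Sum>i=1..<k. c i k))"
    by (simp only: S)
  then show ?thesis
    by (simp add: harm_def sum.distrib sum_subtractf sum_distrib_left inverse_eq_divide)
qed

text \<open>A negative correlation is at least \<open>-1/(ik)\<close>; the geometric mean of this bound and of the exponential
  one is summable.\<close>

lemma neg_sum_c_le:
  assumes k: "1 \<le> k"
  shows "- (\<Sum>i=1..<k. c i k) \<le> sqrt F / (1 - sqrt \<theta>)\<^sup>2 * real k powr (- 3 / 2)"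
proof -
  let ?\<rho> = "sqrt \<theta>"
  have \<rho>: "0 \<le> ?\<rho>" "?\<rho> < 1" using \<theta> by auto
  have kk: "real k * sqrt (real k) = real k powr (3 / 2)"
    using k by (simp add: powr_half_sqrt[symmetric] powr_mult_base)
  have "- c i k \<le> sqrt F * real k powr (- 3 / 2) * ((1 + real (k - i)) * ?\<rho> ^ (k - i))" (is "_ \<le> ?R")
    if i: "i \<in> {1..<k}" for i
  proof (cases "0 \<le> c i k")
    case True
    then show ?thesis using F_nonneg \<rho> by (smt (verit) mult_nonneg_nonneg of_nat_0_le_iff powr_ge_zero real_sqrt_ge_zero zero_le_power)
  next
    case False
    have i1: "1 \<le> i" using i by simp
    have le: "- c i k \<le> 1 / (real i * real k)"
      using c_eq[OF i1 k] measure_nonneg[of M "B i \<inter> (T ^^ (k - i)) -` B k"] by linarith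
    \<comment> \<open>One factor is bounded by the exponential estimate, the other by
      \<open>1/(ik)\<close>.\<close>
    have "(- c i k)\<^sup>2 \<le> (F * \<theta> ^ (k - i) / real k) * (1 / (real i * real k))"
      unfolding power2_eq_square using abs_c_le[OF i1 k] le False by (intro mult_mono) auto
    also have "\<dots> = F * \<theta> ^ (k - i) * (1 / real i) / (real k)\<^sup>2"
      by (simp add: power2_eq_square)
    \<comment> \<open>The weight is squared on purpose: after taking roots it becomes
      \<open>1 + (k - i)\<close>, as in \<open>sum_weighted_geometric_diff_le\<close>, and the
      powers of \<open>k\<close> combine to \<open>k powr (- 3 / 2)\<close>.\<close>
    also have "\<dots> \<le> F * \<theta> ^ (k - i) * ((1 + real (k - i))\<^sup>2 / real k) / (real k)\<^sup>2"
    proof (intro divide_right_mono mult_left_mono)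
      have "real k \<le> real i * (1 + real (k - i))"
        using i by (intro le_mult_Suc_diff) auto
      also have "\<dots> \<le> real i * (1 + real (k - i))\<^sup>2"
        by (intro mult_left_mono) (auto simp: power2_eq_square algebra_simps)
      finally show "1 / real i \<le> (1 + real (k - i))\<^sup>2 / real k"
        using i by (simp add: field_simps)
    qed (use F_nonneg \<theta> in auto)
    also have "\<dots> = ?R\<^sup>2"
    proof -
      have "(real k powr (- 3 / 2))\<^sup>2 = 1 / (real k)\<^sup>2 / real k"
        using k by (simp add: powr_minus_divide kk[symmetric] power_mult_distrib power_divide)
      moreover have "(?\<rho> ^ (k - i))\<^sup>2 = \<theta> ^ (k - i)"
        using \<theta> by (simp add: power_mult[symmetric] mult.commute[of _ 2] power_mult)
      ultimately show ?thesis
        using F_nonneg by (simp add: power_mult_distrib mult_ac)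
    qed
    finally show ?thesis
      by (rule power2_le_imp_le) (use F_nonneg \<rho> in auto)
  qed
  then have "- (\<Sum>i=1..<k. c i k) \<le> (\<Sum>i=1..<k. sqrt F * real k powr (- 3 / 2) * ((1 + real (k - i)) * ?\<rho> ^ (k - i)))"
    unfolding sum_negf[symmetric] by (rule sum_mono)
  also have "\<dots> \<le> sqrt F * real k powr (- 3 / 2) * (1 / (1 - ?\<rho>)\<^sup>2)"
    unfolding sum_distrib_left[symmetric] using F_nonneg
    by (intro mult_left_mono sum_weighted_geometric_diff_le[OF \<rho>]) auto
  finally show ?thesis by (simp add: mult_ac)
qed

text \<open>In \<open>hits_sd_square_eq\<close> the harmonic sum gives the logarithm, while the
  squared means and the negative part of the correlations are bounded by convergent series.\<close>

lemma hits_sd_square_ge: "\<exists>D. \<forall>n. ln (real n) - D \<le> (hits_sd M T B n)\<^sup>2"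
proof -
  obtain D0 where D0: "\<And>n. \<bar>harm n - ln (real n)\<bar> \<le> D0" using abs_harm_minus_ln_bounded by blast
  define D1 where "D1 = (\<Sum>k. real k powr (- 3 / 2))"
  define D2 where "D2 = (\<Sum>k. real k powr (- 2))"
  define E where "E = sqrt F / (1 - sqrt \<theta>)\<^sup>2"
  have E: "0 \<le> E" using F_nonneg by (simp add: E_def)
  have "ln (real n) - (D0 + D2 + 2 * (E * D1)) \<le> (hits_sd M T B n)\<^sup>2" for n
  proof -
    have "(\<Sum>k=1..n. 1 / (real k)\<^sup>2) = (\<Sum>k=1..n. real k powr (- 2))"
      by (rule sum.cong) (auto simp: powr_minus_divide powr_numeral)
    also have "\<dots> \<le> D2"
      unfolding D2_def by (rule summable_sum_bound) (auto simp: summable_real_powr_iff)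
    finally have 2: "(\<Sum>k=1..n. 1 / (real k)\<^sup>2) \<le> D2" .
    have "- (\<Sum>k=1..n. \<Sum>i=1..<k. c i k) \<le> (\<Sum>k=1..n. E * real k powr (- 3 / 2))"
      unfolding sum_negf[symmetric] E_def by (intro sum_mono) (rule neg_sum_c_le[unfolded sum_negf[symmetric]], simp)
    also have "\<dots> \<le> E * D1"
      unfolding D1_def sum_distrib_left[symmetric]
      by (intro mult_left_mono E summable_sum_bound) (auto simp: summable_real_powr_iff)
    finally show ?thesis
      using 2 D0[of n] unfolding hits_sd_square_eq by linarith
  qed
  then show ?thesis by blast
qed

text \<open>The correlations are collected by the earlier time \<open>i\<close>. Those at distance
  at most \<open>L i\<close> number at most \<open>L i\<close> and are each bounded through
  assumption (C), giving \<open>X i\<close>; the more distant ones are bounded by exponential decay,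
  giving \<open>Y i\<close>. Both series converge.\<close>

lemma hits_sd_square_le:
  assumes "assumption_C M T B"
  shows "\<exists>D. \<forall>n. (hits_sd M T B n)\<^sup>2 \<le> ln (real n) + D"
proof -
  obtain \<eta> \<kappa> :: real where \<eta>: "0 < \<eta>" "1 < \<kappa>"
    and ev: "\<forall>\<^sub>F i in sequentially. \<forall>r::nat. 1 \<le> r \<and> real r \<le> ln (real i) powr \<kappa> \<longrightarrow>
           measure M (B i \<inter> (T ^^ r) -` B i) \<le> measure M (B i) powr (1 + \<eta>)"
    using assms by (auto simp: assumption_C_def)
  obtain N where N: "\<And>i r. N \<le> i \<Longrightarrow> 1 \<le> r \<Longrightarrow> real r \<le> ln (real i) powr \<kappa> \<Longrightarrow>
      measure M (B i \<inter> (T ^^ r) -` B i) \<le> measure M (B i) powr (1 + \<eta>)"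
    using ev by (auto simp: eventually_sequentially)
  \<comment> \<open>Half of the exponential rate is spent on \<open>?\<rho> powr L i\<close>, the
    other half on a convergent geometric sum over \<open>k\<close>.\<close>
  let ?\<rho> = "sqrt \<theta>"
  have \<rho>: "0 < ?\<rho>" "?\<rho> < 1" using \<theta> by auto
  define L where "L i = ln (real i) powr \<kappa>" for i :: nat
  define G' where "G' = 1 / (1 - ?\<rho>)\<^sup>2"
  have G': "0 \<le> G'" by (simp add: G'_def)
  define X where "X i = L i * (1 / real i) powr (1 + \<eta>)" for i :: nat
  define Y where "Y i = F * G' * (?\<rho> powr L i / real i)" for i :: nat
  define W where "W i = (if i < N then F * G else X i + Y i)" for i :: nat
  have XY: "0 \<le> X i" "0 \<le> Y i" for i
    using F_nonneg G' by (auto simp: X_def Y_def L_def)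
  have W0: "0 \<le> W i" for i using XY[of i] F_nonneg G_nonneg by (simp add: W_def)
  have sumX: "summable X"
  proof (rule summable_comparison_test_bigo)
    \<comment> \<open>Half of \<open>\<eta>\<close> absorbs the power of the logarithm.\<close>
    show "X \<in> O(\<lambda>i. real i powr (- 1 - \<eta> / 2))"
      unfolding X_def[abs_def] L_def using \<eta> by real_asymp
    show "summable (\<lambda>i. norm (real i powr (- 1 - \<eta> / 2)))"
      using \<eta> by (simp add: summable_real_powr_iff)
  qed
  have sumY: "summable Y"
  proof -
    define a where "a = - ln ?\<rho>"
    have a: "0 < a" using \<rho> by (simp add: a_def ln_less_zero_iff)
    have Y: "Y = (\<lambda>i. F * G' * (exp (- a * ln (real i) powr \<kappa>) / real i))"
      using \<rho> \<theta> by (auto simp: Y_def L_def powr_def[of ?\<rho>] a_def mult.commute)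
    have "summable (\<lambda>i. exp (- a * ln (real i) powr \<kappa>) / real i)"
    proof (rule summable_comparison_test_bigo)
      \<comment> \<open>As \<open>\<kappa> > 1\<close>, the exponential is eventually smaller than
        any power of \<open>i\<close>, in particular than \<open>1 / i\<close>.\<close>
      show "(\<lambda>i. exp (- a * ln (real i) powr \<kappa>) / real i) \<in> O(\<lambda>i. real i powr (- 2))"
        using a \<eta> by real_asymp
      show "summable (\<lambda>i. norm (real i powr (- 2)))"
        by (simp add: summable_real_powr_iff)
    qed
    then show ?thesis unfolding Y by (rule summable_mult)
  qed
  have "\<forall>\<^sub>F i in sequentially. X i + Y i = W i"
    using eventually_ge_at_top[of N] by eventually_elim (simp add: W_def)
  from summable_cong[OF this] have sumW: "summable W"
    using summable_add[OF sumX sumY] by simp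
  have W: "(\<Sum>k=Suc i..n. c i k) \<le> W i" if i: "1 \<le> i" for i n
  proof (cases "i < N")
    case True
    have "(\<Sum>k=Suc i..n. c i k) \<le> (\<Sum>k=Suc i..n. F * \<theta> ^ (k - i))"
    proof (rule sum_mono)
      fix k assume k: "k \<in> {Suc i..n}"
      have "c i k \<le> F * \<theta> ^ (k - i) / real k" using abs_c_le[of i k] i k by simp
      also have "\<dots> \<le> F * \<theta> ^ (k - i) / 1"
        using k F_nonneg \<theta> by (intro divide_left_mono) auto
      finally show "c i k \<le> F * \<theta> ^ (k - i)" by simp
    qed
    also have "\<dots> \<le> F * G"
      unfolding sum_distrib_left[symmetric] G_def using \<theta> F_nonneg
      by (intro mult_left_mono sum_geometric_le) (auto simp: inj_on_def)
    finally show ?thesis using True by (simp add: W_def)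
  next
    case False
    let ?p = "(1 / real i) powr (1 + \<eta>)"
    have "(\<Sum>k=Suc i..n. c i k) \<le> (\<Sum>k=Suc i..n. (if real (k - i) \<le> L i then ?p else 0) + F * (?\<rho> powr L i / real i) * ?\<rho> ^ (k - i))"
    proof (rule sum_mono)
      fix k assume k: "k \<in> {Suc i..n}"
      define r where "r = k - i"
      have r: "1 \<le> r" using k by (auto simp: r_def)
      have nn: "0 \<le> F * (?\<rho> powr L i / real i) * ?\<rho> ^ r" using F_nonneg \<rho> by simp
      show "c i k \<le> (if real (k - i) \<le> L i then ?p else 0) + F * (?\<rho> powr L i / real i) * ?\<rho> ^ (k - i)"
      proof (cases "real r \<le> L i")
        case True
        have Bi: "B i \<in> sets M" using i by (rule B_sets)
        \<comment> \<open>Assumption (C) concerns returns to the same ball; nestedness replaces the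
          later target \<open>B k\<close> by \<open>B i\<close>.\<close>
        have sub: "B k \<subseteq> B i"
        proof -
          have "i \<le> k" using k by simp
          then show ?thesis
          proof (induction k rule: dec_induct)
            case (step m)
            then show ?case using B_nested[of m] i by auto
          qed simp
        qed
        have "B i \<inter> (T ^^ r) -` B i = B i \<inter> ((T ^^ r) -` B i \<inter> space M)"
          using sets.sets_into_space[OF Bi] by auto
        then have m: "B i \<inter> (T ^^ r) -` B i \<in> sets M"
          using Bi by (simp add: measurable_sets[OF T_pow_measurable])
        have "c i k \<le> measure M (B i \<inter> (T ^^ r) -` B k)"
          using c_eq[of i k] i k by (simp add: r_def)
        also have "\<dots> \<le> measure M (B i \<inter> (T ^^ r) -` B i)"
          using sub m by (intro finite_measure_mono) auto
        also have "\<dots> \<le> ?p"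
          using N[of i r] False r True B_measure[OF i] by (simp add: L_def)
        finally show ?thesis using True nn by (simp add: r_def)
      next
        case F: False
        have "?\<rho> ^ r = ?\<rho> powr real r" using \<rho> \<theta> by (simp add: powr_realpow)
        also have "\<dots> \<le> ?\<rho> powr L i" using F \<rho> \<theta> by (intro powr_mono') auto
        finally have "?\<rho> ^ r * ?\<rho> ^ r \<le> ?\<rho> powr L i * ?\<rho> ^ r"
          using \<rho> by (intro mult_right_mono) auto
        then have \<theta>r: "\<theta> ^ r \<le> ?\<rho> powr L i * ?\<rho> ^ r"
          using \<theta> by (simp flip: power_mult_distrib)
        have "c i k \<le> F * \<theta> ^ r / real k" using abs_c_le[of i k] i k by (simp add: r_def)
        also have "\<dots> \<le> F * \<theta> ^ r / real i"
          using k i F_nonneg \<theta> by (intro divide_left_mono) auto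
        also have "\<dots> \<le> F * (?\<rho> powr L i * ?\<rho> ^ r) / real i"
          using \<theta>r F_nonneg by (intro divide_right_mono mult_left_mono) auto
        finally show ?thesis using F by (simp add: r_def)
      qed
    qed
    also have "\<dots> = (\<Sum>k=Suc i..n. if real (k - i) \<le> L i then ?p else 0)
        + F * (?\<rho> powr L i / real i) * (\<Sum>k=Suc i..n. ?\<rho> ^ (k - i))"
      unfolding sum_distrib_left by (rule sum.distrib)
    also have "\<dots> \<le> X i + Y i"
    proof (rule add_mono)
      let ?S = "{k \<in> {Suc i..n}. real (k - i) \<le> L i}"
      have "?S \<subseteq> {i<..i + nat \<lfloor>L i\<rfloor>}"
      proof
        fix k assume "k \<in> ?S"
        then have "i < k" "k - i \<le> nat \<lfloor>L i\<rfloor>" using le_nat_floor[of "k - i" "L i"] by auto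
        then show "k \<in> {i<..i + nat \<lfloor>L i\<rfloor>}" by auto
      qed
      then have "card ?S \<le> card {i<..i + nat \<lfloor>L i\<rfloor>}" by (rule card_mono[rotated]) simp
      then have "real (card ?S) \<le> real (nat \<lfloor>L i\<rfloor>)" by simp
      also have "\<dots> \<le> L i" by (simp add: L_def)
      finally have "real (card ?S) * ?p \<le> L i * ?p" by (rule mult_right_mono) simp
      then show "(\<Sum>k=Suc i..n. if real (k - i) \<le> L i then ?p else 0) \<le> X i"
        by (simp only: sum.inter_filter[OF finite_atLeastAtMost, symmetric] sum_constant X_def)
      have "F * (?\<rho> powr L i / real i) * (\<Sum>k=Suc i..n. ?\<rho> ^ (k - i)) \<le> F * (?\<rho> powr L i / real i) * G'"
        unfolding G'_def using \<rho> F_nonneg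
        by (intro mult_left_mono sum_geometric_le) (auto simp: inj_on_def)
      then show "F * (?\<rho> powr L i / real i) * (\<Sum>k=Suc i..n. ?\<rho> ^ (k - i)) \<le> Y i"
        by (simp add: Y_def mult_ac)
    qed
    finally show ?thesis using False by (simp add: W_def)
  qed
  obtain D0 where D0: "\<And>n. \<bar>harm n - ln (real n)\<bar> \<le> D0" using abs_harm_minus_ln_bounded by blast
  have "(hits_sd M T B n)\<^sup>2 \<le> ln (real n) + (D0 + 2 * suminf W)" for n
  proof -
    \<comment> \<open>Exchange the order of summation, since the bounds \<open>W i\<close> are
      indexed by the earlier time.\<close>
    have "(\<Sum>k=1..n. \<Sum>i=1..<k. c i k) = (\<Sum>k=1..n. \<Sum>i=1..n. if i < k then c i k else 0)"
      by (rule sum.cong[OF refl], rule sum.mono_neutral_cong_left) auto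
    also have "\<dots> = (\<Sum>i=1..n. \<Sum>k=1..n. if i < k then c i k else 0)"
      by (rule sum.swap)
    also have "\<dots> = (\<Sum>i=1..n. \<Sum>k=Suc i..n. c i k)"
      by (rule sum.cong[OF refl], rule sum.mono_neutral_cong_right) auto
    also have "\<dots> \<le> (\<Sum>i=1..n. W i)" using W by (intro sum_mono) auto
    also have "\<dots> \<le> suminf W" by (rule summable_sum_bound[OF sumW W0])
    finally have "(\<Sum>k=1..n. \<Sum>i=1..<k. c i k) \<le> suminf W" .
    moreover have "0 \<le> (\<Sum>k=1..n. 1 / (real k)\<^sup>2)" by (intro sum_nonneg) auto
    ultimately show ?thesis
      using D0[of n] unfolding hits_sd_square_eq by linarith
  qed
  then show ?thesis by blast
qed

section \<open>Consequences for the two normalisations\<close>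

lemma hits_sd_nonneg: "0 \<le> hits_sd M T B n"
  by (simp add: hits_sd_def)

lemma hits_sd_at_top: "filterlim (hits_sd M T B) at_top sequentially"
proof -
  obtain D where D: "\<And>n. ln (real n) - D \<le> (hits_sd M T B n)\<^sup>2" using hits_sd_square_ge by blast
  have "filterlim (\<lambda>n. sqrt (ln (real n) - D)) at_top sequentially" by real_asymp
  then show ?thesis
    by (rule filterlim_at_top_mono) (auto intro!: always_eventually real_le_lsqrt hits_sd_nonneg D)
qed

text \<open>Compare with \<open>sqrt (ln n - D) / sqrt (ln n)\<close>, which tends to 1. For small
  \<open>n\<close> the numerator may be negative, since \<open>sqrt\<close> is odd, and the
  comparison still holds.\<close>

lemma limsup_hits_sd: "1 \<le> limsup (\<lambda>n. ereal (hits_sd M T B n / sqrt (ln (real n))))"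
proof -
  obtain D where D: "\<And>n. ln (real n) - D \<le> (hits_sd M T B n)\<^sup>2" using hits_sd_square_ge by blast
  have "(\<lambda>n. sqrt (ln (real n) - D) / sqrt (ln (real n))) \<longlonglongrightarrow> 1" by real_asymp
  then have "limsup (\<lambda>n. ereal (sqrt (ln (real n) - D) / sqrt (ln (real n)))) = ereal 1"
    by (intro lim_imp_Limsup) auto
  moreover have "limsup (\<lambda>n. ereal (sqrt (ln (real n) - D) / sqrt (ln (real n))))
      \<le> limsup (\<lambda>n. ereal (hits_sd M T B n / sqrt (ln (real n))))"
  proof (intro Limsup_mono, rule eventually_mono[OF eventually_ge_at_top[of 1]])
    fix n :: nat assume "1 \<le> n"
    then show "ereal (sqrt (ln (real n) - D) / sqrt (ln (real n))) \<le> ereal (hits_sd M T B n / sqrt (ln (real n)))"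
      using D[of n] hits_sd_nonneg[of n] by (auto intro!: divide_right_mono real_le_lsqrt)
  qed
  ultimately show ?thesis by (simp add: one_ereal_def)
qed

text \<open>The lower bound for the variance gives \<open>harm n\<close> at most the variance plus a
  constant, hence at most a multiple of the variance once the latter exceeds 1.\<close>

lemma clt_hits_sd:
  "weak_conv_m (\<lambda>n. distr M borel (\<lambda>x. centred_hits T B n x / hits_sd M T B n)) std_normal_distribution"
proof (rule centred_hits_clt[OF hits_sd_at_top])
  have ev: "\<forall>\<^sub>F n in sequentially. 1 \<le> hits_sd M T B n"
    using hits_sd_at_top by (auto simp: filterlim_at_top)
  show "(\<lambda>n. (hits_sd M T B n)\<^sup>2 / (hits_sd M T B n)\<^sup>2) \<longlonglongrightarrow> 1"
    by (rule tendsto_eventually) (use ev in eventually_elim, auto)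
  obtain D where D: "\<And>n. ln (real n) - D \<le> (hits_sd M T B n)\<^sup>2" using hits_sd_square_ge by blast
  obtain D0 where D0: "\<And>n. \<bar>harm n - ln (real n)\<bar> \<le> D0" using abs_harm_minus_ln_bounded by blast
  show "(\<lambda>n. harm n / (hits_sd M T B n)\<^sup>2) \<in> O(\<lambda>_. 1)"
  proof (rule landau_o.bigI[of "1 + \<bar>D\<bar> + D0"])
    show "0 < 1 + \<bar>D\<bar> + D0" using D0[of 1] by linarith
    show "\<forall>\<^sub>F n in sequentially. norm (harm n / (hits_sd M T B n)\<^sup>2) \<le> (1 + \<bar>D\<bar> + D0) * norm (1::real)"
      using ev
    proof eventually_elim
      case (elim n)
      have 1: "1 \<le> (hits_sd M T B n)\<^sup>2" using elim by (simp add: one_le_power)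
      have "harm n \<le> (hits_sd M T B n)\<^sup>2 + (\<bar>D\<bar> + D0)"
        using D[of n] D0[of n] by linarith
      also have "\<dots> \<le> (hits_sd M T B n)\<^sup>2 + (\<bar>D\<bar> + D0) * (hits_sd M T B n)\<^sup>2"
        using mult_left_mono[OF 1, of "\<bar>D\<bar> + D0"] D0[of n] by simp
      moreover have "hits_sd M T B n \<noteq> 0" using elim by auto
      ultimately show ?case
        using 1 harm_nonneg[of n, where 'a = real] by (simp add: divide_le_eq algebra_simps)
    qed
  qed
qed

lemma clt_sqrt_ln:
  assumes "(\<lambda>n. (hits_sd M T B n)\<^sup>2 - ln (real n)) \<in> O(\<lambda>_. 1)"
  shows "weak_conv_m (\<lambda>n. distr M borel (\<lambda>x. centred_hits T B n x / sqrt (ln (real n)))) std_normal_distribution"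
proof (rule centred_hits_clt)
  show "filterlim (\<lambda>n. sqrt (ln (real n))) at_top sequentially" by real_asymp
  have sq: "\<forall>\<^sub>F n in sequentially. (sqrt (ln (real n)))\<^sup>2 = ln (real n) \<and> 0 < ln (real n)"
    using eventually_gt_at_top[of 1] by eventually_elim auto
  have o: "(\<lambda>_. 1) \<in> o(\<lambda>n. ln (real n))" by real_asymp
  have "((\<lambda>n. ((hits_sd M T B n)\<^sup>2 - ln (real n)) / ln (real n)) \<longlongrightarrow> 0) sequentially"
    by (rule smalloD_tendsto[OF landau_o.big_small_trans[OF assms o]])
  then have "(\<lambda>n. ((hits_sd M T B n)\<^sup>2 - ln (real n)) / ln (real n) + 1) \<longlonglongrightarrow> 0 + 1"
    by (intro tendsto_intros)
  then have t: "(\<lambda>n. ((hits_sd M T B n)\<^sup>2 - ln (real n)) / ln (real n) + 1) \<longlonglongrightarrow> 1" by simp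
  show "(\<lambda>n. (hits_sd M T B n)\<^sup>2 / (sqrt (ln (real n)))\<^sup>2) \<longlonglongrightarrow> 1"
    \<comment> \<open>Adding 1 to the quotient gives the ratio itself only where
      \<open>ln (real n)\<close> is nonzero, hence eventually.\<close>
    by (rule Lim_transform_eventually[OF t]) (use sq in eventually_elim, simp add: field_simps)
  obtain D0 where D0: "\<And>n. \<bar>harm n - ln (real n)\<bar> \<le> D0" using abs_harm_minus_ln_bounded by blast
  have ln1: "\<forall>\<^sub>F n in sequentially. 1 \<le> ln (real n)" by real_asymp
  show "(\<lambda>n. harm n / (sqrt (ln (real n)))\<^sup>2) \<in> O(\<lambda>_. 1)"
  proof (rule landau_o.bigI[of "1 + D0"])
    show "0 < 1 + D0" using D0[of 1] by linarith
    show "\<forall>\<^sub>F n in sequentially. norm (harm n / (sqrt (ln (real n)))\<^sup>2) \<le> (1 + D0) * norm (1::real)"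
      using ln1
    proof eventually_elim
      case (elim n)
      have "harm n \<le> ln (real n) + D0" using D0[of n] by linarith
      also have "\<dots> \<le> ln (real n) + D0 * ln (real n)"
        using mult_left_mono[OF elim, of D0] D0[of n] by simp
      finally show ?case
        using elim harm_nonneg[of n, where 'a = real] by (simp add: divide_le_eq algebra_simps)
    qed
  qed
qed

lemma hits_sd_square_asymp:
  assumes "assumption_C M T B"
  shows "(\<lambda>n. (hits_sd M T B n)\<^sup>2 - ln (real n)) \<in> O(\<lambda>_. 1)"
proof -
  obtain D where D: "\<And>n. ln (real n) - D \<le> (hits_sd M T B n)\<^sup>2" using hits_sd_square_ge by blast
  obtain D' where D': "\<And>n. (hits_sd M T B n)\<^sup>2 \<le> ln (real n) + D'" using hits_sd_square_le[OF assms] by blast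
  have "\<bar>(hits_sd M T B n)\<^sup>2 - ln (real n)\<bar> \<le> \<bar>D\<bar> + \<bar>D'\<bar>" for n
    using D[of n] D'[of n] by linarith
  then show ?thesis by (intro bigoI[of _ "\<bar>D\<bar> + \<bar>D'\<bar>"]) auto
qed

end

theorem proposition5p1:
  fixes M :: "'a::metric_space measure"
    and T :: "'a \<Rightarrow> 'a"
    and P :: "('a \<Rightarrow> real) \<Rightarrow> ('a \<Rightarrow> real)"
    and K :: "'a list set"
    and p :: 'a
    and r :: "nat \<Rightarrow> real"
    and B :: "nat \<Rightarrow> 'a set"
  assumes "ergodic_system M T"
    and "transfer_operator M T P"
    and "K \<subseteq> lists (space M)"
    and "\<exists>C. \<forall>\<phi>\<in>BV M K. AE x in M. \<bar>\<phi> x\<bar> \<le> C * bv_norm M K \<phi>"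
    and "\<exists>C>0. \<exists>\<theta>>0. \<theta> < 1 \<and>
           (\<forall>n. \<forall>\<phi>\<in>BV M K. (\<integral>x. \<phi> x \<partial>M) = 0 \<longrightarrow>
              (P ^^ n) \<phi> \<in> BV M K \<and> bv_norm M K ((P ^^ n) \<phi>) \<le> C * \<theta> ^ n * bv_norm M K \<phi>)"
    and "p \<in> space M"
    and "\<forall>i\<ge>1. B i = ball p (r i) \<inter> space M"
    and "\<forall>i\<ge>1. B (Suc i) \<subseteq> B i"
    and "\<forall>i\<ge>1. measure M (B i) = 1 / real i"
    and "\<exists>C. \<forall>i\<ge>1. indicator (B i) \<in> BV M K \<and> bv_norm M K (indicator (B i)) \<le> C"
  shows "(limsup (\<lambda>n. ereal (hits_sd M T B n / sqrt (ln (real n)))) \<ge> 1 \<and>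
          weak_conv_m (\<lambda>n. distr M borel (\<lambda>x. centred_hits T B n x / hits_sd M T B n))
            std_normal_distribution) \<and>
         (assumption_C M T B \<longrightarrow>
          (\<lambda>n. (hits_sd M T B n)\<^sup>2 - ln (real n)) \<in> O(\<lambda>_. 1) \<and>
          weak_conv_m (\<lambda>n. distr M borel (\<lambda>x. centred_hits T B n x / sqrt (ln (real n))))
            std_normal_distribution)"
proof -
  obtain C\<^sub>1 where C\<^sub>1: "\<And>\<phi>. \<phi> \<in> BV M K \<Longrightarrow> AE x in M. \<bar>\<phi> x\<bar> \<le> C\<^sub>1 * bv_norm M K \<phi>"
    using assms(4) by blast
  obtain C\<^sub>2 \<theta> where \<theta>: "0 < \<theta>" "\<theta> < 1"
    and C\<^sub>2: "\<And>n \<phi>. \<phi> \<in> BV M K \<Longrightarrow> (\<integral>x. \<phi> x \<partial>M) = 0 \<Longrightarrow>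
      (P ^^ n) \<phi> \<in> BV M K \<and> bv_norm M K ((P ^^ n) \<phi>) \<le> C\<^sub>2 * \<theta> ^ n * bv_norm M K \<phi>"
    using assms(5) by blast
  obtain b where b: "\<And>i. 1 \<le> i \<Longrightarrow> indicator (B i) \<in> BV M K \<and> bv_norm M K (indicator (B i)) \<le> b"
    using assms(10) by blast
  \<comment> \<open>The constants obtained are merged; enlarging them is harmless because
    \<open>bv_norm\<close> is nonnegative.\<close>
  define C where "C = max 1 (max C\<^sub>1 C\<^sub>2)"
  have le: "C\<^sub>1 * bv_norm M K \<phi> \<le> C * bv_norm M K \<phi>" "C\<^sub>2 * \<theta> ^ n * bv_norm M K \<phi> \<le> C * \<theta> ^ n * bv_norm M K \<phi>"
    for \<phi> n
    using \<theta> by (auto simp: C_def intro!: mult_right_mono bv_norm_nonneg)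
  interpret prob_space M using assms(1) by (simp add: ergodic_system_def)
  interpret shrinking_targets M T P K C \<theta> B b
  proof unfold_locales
    show "T \<in> measurable M M" "distr M M T = M" using assms(1) by (auto simp: ergodic_system_def)
    show "AE x in M. \<bar>\<phi> x\<bar> \<le> C * bv_norm M K \<phi>" if "\<phi> \<in> BV M K" for \<phi>
      using C\<^sub>1[OF that] by eventually_elim (use le(1)[of \<phi>] in linarith)
    show "(P ^^ n) \<phi> \<in> BV M K \<and> bv_norm M K ((P ^^ n) \<phi>) \<le> C * \<theta> ^ n * bv_norm M K \<phi>"
      if "\<phi> \<in> BV M K" "(\<integral>x. \<phi> x \<partial>M) = 0" for \<phi> n
      using C\<^sub>2[OF that, of n] le(2)[of n \<phi>] by linarith
  qed (use assms(2,8,9) \<theta> b in \<open>auto simp: C_def\<close>)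
  show ?thesis
    using limsup_hits_sd clt_hits_sd hits_sd_square_asymp clt_sqrt_ln by blast
qed

end
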